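(* Let $m,n\ge1$ with $\gcd(m,n)=1$, $d=m+n$, and let $A\in\operatorname{Mat}_{m\times n}(\mathbb{R})$ be such that the lattice $x_A$ has an accumulation sequence of length $d$ (equivalently, $A$ is not $k$-divergent for any $0\le k\le d-2$). Then for every non-trivial algebraic probability measure $\mu$ on $\mathbb{T}^m$ we have $\mu(\operatorname{Bad}_A)=0$.
   Context: Fix norms $\|\cdot\|$ on $\mathbb{R}^m$ and $\mathbb{R}^n$; $\langle z\rangle=\min_{p\in\mathbb{Z}^m}\|z-p\|$ for $z\in\mathbb{R}^m$. $\operatorname{Bad}_A=\{\eta\in\mathbb{T}^m:\liminf_{q\in\mathbb{Z}^n,\|q\|\to\infty}\|q\|^{n/m}\langle Aq-\eta\rangle>0\}$. Let $X$ be the space of unimodular lattices in $\mathbb{R}^d$, identified with $\operatorname{SL}_d(\mathbb{R})/\operatorname{SL}_d(\mathbb{Z})$ with the quotient topology; $\operatorname{SL}_d(\mathbb{R})$ acts on $X$ linearly. Let $h_t=\operatorname{diag}(e^{nt}I_m,e^{-mt}I_n)$ and $x_A=\begin{pmatrix}I_m&A\\0&I_n\end{pmatrix}\mathbb{Z}^d$. For $x\in X$, $\partial(x)$ is the set of $y\in X$ for which there is an unbounded sequence $(t_k)\subset\mathbb{R}_{\ge0}$ with $h_{t_k}x\to y$. An accumulation sequence of length $k+1$ for $x$ is a tuple $(x_0=x,x_1,\dots,x_k)\in X^{k+1}$ with $x_{i+1}\in\partial(x_i)$ for all $i$; $x$ is $k$-divergent if $k$ is the supremum of (length$-1$) over its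 accumulation sequences, and $A$ is $k$-divergent if $x_A$ is. A probability measure $\mu$ on $\mathbb{T}^m$ is algebraic if there is a subspace $U\le\mathbb{R}^m$ with $U\cap\mathbb{Z}^m$ a lattice in $U$ such that $\mu$ is the $U$-invariant probability measure on a single $U$-orbit in $\mathbb{T}^m$; non-trivial means $U\ne\{0\}$. *)

theory Defs
  imports "HOL-Probability.Probability"
begin

section \<open>Quotient topologies\<close>

definition quotient_top :: "'a topology \<Rightarrow> ('a \<Rightarrow> 'b) \<Rightarrow> 'b topology" where
  "quotient_top T f =
     topology (\<lambda>V. V \<subseteq> f ` topspace T \<and> openin T {x \<in> topspace T. f x \<in> V})"

lemma openin_quotient_top:
  "openin (quotient_top T f) V \<longleftrightarrow>
     V \<subseteq> f ` topspace T \<and> openin T {x \<in> topspace T. f x \<in> V}"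
proof -
  let ?P = "\<lambda>V. V \<subseteq> f ` topspace T \<and> openin T {x \<in> topspace T. f x \<in> V}"
  have "istopology ?P"
    unfolding istopology_def
  proof (intro conjI allI impI)
    fix V W assume "?P V" "?P W"
    moreover have "{x \<in> topspace T. f x \<in> V \<inter> W} =
        {x \<in> topspace T. f x \<in> V} \<inter> {x \<in> topspace T. f x \<in> W}" by blast
    ultimately show "V \<inter> W \<subseteq> f ` topspace T" "openin T {x \<in> topspace T. f x \<in> V \<inter> W}"
      by (auto intro: openin_Int)
  next
    fix K assume "\<forall>V\<in>K. ?P V"
    moreover have "{x \<in> topspace T. f x \<in> \<Union>K} = (\<Union>V\<in>K. {x \<in> topspace T. f x \<in> V})"
      by blast
    ultimately show "\<Union>K \<subseteq> f ` topspace T" "openin T {x \<in> topspace T. f x \<in> \<Union>K}"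
      by (auto intro: openin_Union)
  qed
  then show ?thesis
    by (simp add: quotient_top_def topology_inverse')
qed

lemma topspace_quotient_top [simp]: "topspace (quotient_top T f) = f ` topspace T"
proof
  show "topspace (quotient_top T f) \<subseteq> f ` topspace T"
    using openin_quotient_top[of T f "topspace (quotient_top T f)"] by simp
  have "{x \<in> topspace T. f x \<in> f ` topspace T} = topspace T" by blast
  then have "openin (quotient_top T f) (f ` topspace T)"
    by (simp add: openin_quotient_top)
  then show "f ` topspace T \<subseteq> topspace (quotient_top T f)"
    by (rule openin_subset)
qed

lemma quotient_map_quotient_top: "quotient_map T (quotient_top T f) f"
  by (simp add: quotient_map_def openin_quotient_top)

section \<open>Norms and integer vectors\<close>

text \<open>The norms of the statement are arbitrary and unrelated to the Euclidean
  norm of the type class, so they are functions satisfying the norm axioms.\<close>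

definition is_norm :: "('a::real_vector \<Rightarrow> real) \<Rightarrow> bool" where
  "is_norm N \<longleftrightarrow>
     (\<forall>x. N x = 0 \<longleftrightarrow> x = 0) \<and>
     (\<forall>c x. N (c *\<^sub>R x) = \<bar>c\<bar> * N x) \<and>
     (\<forall>x y. N (x + y) \<le> N x + N y)"

lemma is_norm_nonneg:
  assumes "is_norm N"
  shows "0 \<le> N x"
proof -
  have "N (x + (-1) *\<^sub>R x) \<le> N x + N ((-1) *\<^sub>R x)"
    using assms unfolding is_norm_def by blast
  moreover have "N ((-1) *\<^sub>R x) = \<bar>-1\<bar> * N x"
    using assms unfolding is_norm_def by blast
  moreover have "N (x + (-1) *\<^sub>R x) = 0"
    using assms unfolding is_norm_def by simp
  ultimately show ?thesis by simp
qed

definition int_vecs :: "(real^'k) set" where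
  "int_vecs = {v. \<forall>i. v $ i \<in> \<int>}"

text \<open>For a norm, the infimum is a minimum, since only finitely many integer vectors
  lie in a given bounded set.\<close>

definition dist_int :: "(real^'m \<Rightarrow> real) \<Rightarrow> real^'m \<Rightarrow> real" where
  "dist_int N z = (INF p\<in>int_vecs. N (z - p))"

lemma dist_int_add_int:
  assumes "p \<in> int_vecs"
  shows "dist_int N (z + p) = dist_int N z"
proof -
  have "(\<lambda>q. N (z + p - q)) ` int_vecs = (\<lambda>q. N (z - q)) ` int_vecs" (is "?L = ?R")
  proof
    show "?L \<subseteq> ?R"
    proof
      fix r assume "r \<in> ?L"
      then obtain q where "q \<in> int_vecs" "r = N (z + p - q)" by blast
      moreover have "q - p \<in> int_vecs"
        using assms \<open>q \<in> int_vecs\<close> by (simp add: int_vecs_def)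
      moreover have "z + p - q = z - (q - p)" by simp
      ultimately show "r \<in> ?R" by (metis image_eqI)
    qed
    show "?R \<subseteq> ?L"
    proof
      fix r assume "r \<in> ?R"
      then obtain q where "q \<in> int_vecs" "r = N (z - q)" by blast
      moreover have "q + p \<in> int_vecs"
        using assms \<open>q \<in> int_vecs\<close> by (simp add: int_vecs_def)
      moreover have "z - q = z + p - (q + p)" by simp
      ultimately show "r \<in> ?L" by (metis image_eqI)
    qed
  qed
  then show ?thesis by (simp add: dist_int_def)
qed

section \<open>The torus\<close>

text \<open>Points of the torus are cosets of the integer vectors.\<close>

definition torus_proj :: "real^'m \<Rightarrow> (real^'m) set" where
  "torus_proj x = (\<lambda>p. x + p) ` int_vecs"

definition torus_top :: "(real^'m) set topology" where
  "torus_top = quotient_top euclidean torus_proj"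

definition torus_borel :: "(real^'m) set measure" where
  "torus_borel = sigma (topspace torus_top) {V. openin torus_top V}"

definition torus_translate :: "real^'m \<Rightarrow> (real^'m) set \<Rightarrow> (real^'m) set" where
  "torus_translate u c = (\<lambda>y. u + y) ` c"

lemma torus_translate_proj: "torus_translate u (torus_proj x) = torus_proj (u + x)"
  by (simp add: torus_translate_def torus_proj_def image_image add.assoc)

text \<open>A lattice in a subspace is the integer span of a basis of that subspace.\<close>

definition lattice_in :: "(real^'m) set \<Rightarrow> (real^'m) set \<Rightarrow> bool" where
  "lattice_in U L \<longleftrightarrow>
     (\<exists>B. independent B \<and> span B = U \<and>
          L = range (\<lambda>c :: real^'m \<Rightarrow> int. \<Sum>b\<in>B. of_int (c b) *\<^sub>R b))"

definition algebraic_measure_along :: "(real^'m) set \<Rightarrow> (real^'m) set measure \<Rightarrow> bool" where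
  "algebraic_measure_along U \<mu> \<longleftrightarrow>
     subspace U \<and> lattice_in U (U \<inter> int_vecs) \<and>
     prob_space \<mu> \<and> sets \<mu> = sets torus_borel \<and>
     (\<forall>u\<in>U. \<forall>E\<in>sets \<mu>. emeasure \<mu> (torus_translate u ` E) = emeasure \<mu> E) \<and>
     (\<exists>\<xi>\<in>topspace torus_top. emeasure \<mu> ((\<lambda>u. torus_translate u \<xi>) ` U) = 1)"

definition nontrivial_algebraic_measure :: "(real^'m) set measure \<Rightarrow> bool" where
  "nontrivial_algebraic_measure \<mu> \<longleftrightarrow> (\<exists>U. U \<noteq> {0} \<and> algebraic_measure_along U \<mu>)"

section \<open>Badly approximable targets\<close>

definition bad_vec ::
  "(real^'m \<Rightarrow> real) \<Rightarrow> (real^'n \<Rightarrow> real) \<Rightarrow> real^'n^'m \<Rightarrow> real^'m \<Rightarrow> bool" where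
  "bad_vec Nm Nn A y \<longleftrightarrow>
     Liminf (inf (filtercomap Nn at_top) (principal int_vecs))
       (\<lambda>q. ereal (Nn q powr (real CARD('n) / real CARD('m)) * dist_int Nm (A *v q - y))) > 0"

definition Bad ::
  "(real^'m \<Rightarrow> real) \<Rightarrow> (real^'n \<Rightarrow> real) \<Rightarrow> real^'n^'m \<Rightarrow> (real^'m) set set" where
  "Bad Nm Nn A = torus_proj ` {y. bad_vec Nm Nn A y}"

lemma torus_proj_in_Bad_iff: "torus_proj y \<in> Bad Nm Nn A \<longleftrightarrow> bad_vec Nm Nn A y"
proof
  assume "torus_proj y \<in> Bad Nm Nn A"
  then obtain z where z: "bad_vec Nm Nn A z" "torus_proj y = torus_proj z"
    unfolding Bad_def by blast
  have "z \<in> torus_proj z"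
    unfolding torus_proj_def by (rule image_eqI[of _ _ 0]) (simp_all add: int_vecs_def)
  then obtain p where p: "p \<in> int_vecs" "z = y + p"
    using z(2) unfolding torus_proj_def by auto
  have "dist_int Nm (A *v q - y) = dist_int Nm (A *v q - z)" for q
    using dist_int_add_int[OF p(1), of Nm "A *v q - z"] p(2) by simp
  then show "bad_vec Nm Nn A y" using z(1) by (simp add: bad_vec_def)
qed (auto simp: Bad_def)

section \<open>The space of unimodular lattices\<close>

definition SL :: "(real^'d^'d) set" where
  "SL = {g. det g = 1}"

definition act :: "real^'d^'d \<Rightarrow> (real^'d) set \<Rightarrow> (real^'d) set" where
  "act g \<Lambda> = (\<lambda>v. g *v v) ` \<Lambda>"

text \<open>The fibres of the map sending \<open>g\<close> to the lattice \<open>g\<int>\<^sup>d\<close> are the cosets of the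
  integral special linear group, so this is the quotient topology transported to lattices.\<close>

definition lattice_top :: "(real^'d) set topology" where
  "lattice_top = quotient_top (top_of_set SL) (\<lambda>g. act g int_vecs)"

definition block_matrix ::
  "real^'m^'m \<Rightarrow> real^'n^'m \<Rightarrow> real^'m^'n \<Rightarrow> real^'n^'n \<Rightarrow> real^('m + 'n)^('m + 'n)" where
  "block_matrix P Q R S =
     (\<chi> i j. case i of
        Inl a \<Rightarrow> (case j of Inl b \<Rightarrow> P $ a $ b | Inr b \<Rightarrow> Q $ a $ b)
      | Inr a \<Rightarrow> (case j of Inl b \<Rightarrow> R $ a $ b | Inr b \<Rightarrow> S $ a $ b))"

text \<open>Here \<open>mat c\<close> is the scalar matrix with diagonal entries \<open>c\<close>.\<close>

definition flow :: "real \<Rightarrow> real^('m::finite + 'n::finite)^('m + 'n)" where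
  "flow t = block_matrix (mat (exp (real CARD('n) * t))) 0 0 (mat (exp (- real CARD('m) * t)))"

definition lattice_of :: "real^'n^'m \<Rightarrow> (real^('m + 'n)) set" where
  "lattice_of A = act (block_matrix (mat 1) A 0 (mat 1)) int_vecs"

section \<open>Accumulation sequences\<close>

definition accum_pts :: "(real^('m::finite + 'n::finite)) set \<Rightarrow> (real^('m + 'n)) set set" where
  "accum_pts x =
     {y \<in> topspace lattice_top.
        \<exists>t :: nat \<Rightarrow> real. (\<forall>k. 0 \<le> t k) \<and> \<not> bounded (range t) \<and>
          limitin lattice_top (\<lambda>k. act (flow (t k)) x) y sequentially}"

definition accum_seq ::
  "(real^('m::finite + 'n::finite)) set \<Rightarrow> (real^('m + 'n)) set list \<Rightarrow> bool" where
  "accum_seq x xs \<longleftrightarrow>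
     xs \<noteq> [] \<and> xs ! 0 = x \<and> set xs \<subseteq> topspace lattice_top \<and>
     (\<forall>i. Suc i < length xs \<longrightarrow> xs ! Suc i \<in> accum_pts (xs ! i))"

text \<open>The supremum is taken in the extended naturals, as it may be infinite.\<close>

definition divergent_of_order :: "nat \<Rightarrow> (real^('m::finite + 'n::finite)) set \<Rightarrow> bool" where
  "divergent_of_order k x \<longleftrightarrow> enat k = (SUP xs\<in>{xs. accum_seq x xs}. enat (length xs - 1))"

lemma accum_seq_take:
  assumes "accum_seq x xs" "0 < l"
  shows "accum_seq x (take l xs)"
  using assms set_take_subset[of l xs] unfolding accum_seq_def by auto

lemma accum_seq_length_iff_not_divergent:
  assumes "2 \<le> d"
  shows "(\<exists>xs. accum_seq x xs \<and> length xs = d) \<longleftrightarrow> (\<forall>k \<le> d - 2. \<not> divergent_of_order k x)"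
proof
  assume "\<exists>xs. accum_seq x xs \<and> length xs = d"
  then obtain xs where xs: "accum_seq x xs" "length xs = d" by blast
  have "enat (d - 1) \<le> (SUP xs\<in>{xs. accum_seq x xs}. enat (length xs - 1))"
    using xs by (intro SUP_upper2[of xs]) auto
  then show "\<forall>k \<le> d - 2. \<not> divergent_of_order k x"
    unfolding divergent_of_order_def using assms
    by (metis enat_ord_simps(1) diff_le_mono2 Suc_1 Suc_diff_le Suc_n_not_le_n diff_Suc_Suc
        le_trans One_nat_def)
next
  assume nd: "\<forall>k \<le> d - 2. \<not> divergent_of_order k x"
  show "\<exists>xs. accum_seq x xs \<and> length xs = d"
  proof (rule ccontr)
    assume none: "\<not> ?thesis"
    have short: "length xs - 1 \<le> d - 2" if "accum_seq x xs" for xs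
    proof (rule ccontr)
      assume "\<not> length xs - 1 \<le> d - 2"
      then have "length (take d xs) = d" using assms by simp
      then show False using none accum_seq_take[OF that, of d] assms by auto
    qed
    have le: "(SUP xs\<in>{xs. accum_seq x xs}. enat (length xs - 1)) \<le> enat (d - 2)"
      using short by (intro SUP_least) auto
    then obtain k where k: "enat k = (SUP xs\<in>{xs. accum_seq x xs}. enat (length xs - 1))"
      by (metis enat_ile)
    with le have "k \<le> d - 2" by (metis enat_ord_simps(1))
    then show False using nd k unfolding divergent_of_order_def by blast
  qed
qed

end

theory Submission
  imports Defs "HOL-Library.Diagonal_Subsequence"
begin

text \<open>Fix \<open>u \<noteq> 0\<close> in the subspace \<open>U\<close> along which the algebraic measure is invariant. A vector of
  integral coordinates for the dual of \<open>h\<^sub>t x\<^sub>A\<close> restricts to a character of the line \<open>\<real>u\<close>. Along a sequence of times with \<open>h\<^sub>t x\<^sub>A\<close> convergent, a subsequence makes each of these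
  characters either constant or eventually different from every given one. The dual vectors
  whose character is constantly zero span a proper rational subspace; coprimality of \<open>m\<close> and \<open>n\<close> means
  that the flow preserves the covolume of no such nonzero subspace, so its dimension drops at every
  further accumulation step. After \<open>d - 2\<close> steps it is at most one, and a last step leaves no
  nonzero dual vector with a constant character at all. By Bessel's inequality, the translates of
  \<open>h\<^sub>t x\<^sub>A\<close> by points of any set of positive measure then become dense among the
  translates of the last lattice. One of these contains a point \<open>(0, w)\<close> with \<open>w \<noteq> 0\<close>, which contradicts a
  uniform lower bound for \<open>\<parallel>q\<parallel>\<^sup>n\<^sup>/\<^sup>m \<langle>Aq - \<eta>\<rangle>\<close> on a set of positive measure.\<close>

section \<open>Frames and determinants\<close>

text \<open>The order of quantifiers shapes the argument. For each \<delta>, a set of positive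
  measure has only finitely many frequencies on the line at which some Fourier coefficient is at
  least \<delta>, but these are unknown. A character that is merely nonzero on the line is therefore
  not good enough: its frequency has to leave every finite set. Hence labels record every constant
  frequency, not only zero. The dimension count sees only the zero label; it starts at
  \<open>d - 1\<close>, the dimension of a hyperplane, and the separate last step removes the
  nonzero labels as well.

  Later terms of an accumulation sequence are limits of limits. What passes through a limit is a
  finite statement: a nearby basis and finitely many vectors and frequencies, tested at one late
  time on the orbit of the original lattice. The torus side matches this, since a trigonometric
  polynomial of fixed degree detects a ball, so the relevant characters are known before the time is
  chosen.

  Volumes in exterior powers are replaced by determinants of square matrices completed with standard
  basis vectors.\<close>

declare transpose_matrix_vector [simp del]

text \<open>Families instead of sets: a repeated vector counts as a dependence, and the indices
  serve as row numbers of determinants.\<close>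

definition frame :: "'i set \<Rightarrow> ('i \<Rightarrow> 'a::real_vector) \<Rightarrow> bool" where
  "frame I y \<longleftrightarrow> (\<forall>c. (\<Sum>i\<in>I. c i *\<^sub>R y i) = 0 \<longrightarrow> (\<forall>i\<in>I. c i = 0))"

text \<open>For \<open>f\<close> with values in the standard basis, these determinants are zero or,
  up to sign, maximal minors of the family: the coordinates of the wedge product of the
  \<open>y i\<close>.\<close>

definition ext :: "'d set \<Rightarrow> ('d \<Rightarrow> real^'d) \<Rightarrow> ('d \<Rightarrow> real^'d) \<Rightarrow> real^'d^'d" where
  "ext I y f = (\<chi> i. if i \<in> I then y i else f i)"

lemma frame_inj_on:
  assumes "finite I" "frame I y"
  shows "inj_on y I"
proof (rule inj_onI, rule ccontr)
  fix i j assume ij: "i \<in> I" "j \<in> I" "y i = y j" "i \<noteq> j"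
  define c :: "'a \<Rightarrow> real" where "c k = (if k = i then 1 else if k = j then - 1 else 0)" for k
  have "(\<Sum>k\<in>I. c k *\<^sub>R y k) = (\<Sum>k\<in>{i,j}. c k *\<^sub>R y k)"
    using assms(1) ij by (intro sum.mono_neutral_right) (auto simp: c_def)
  also have "\<dots> = 0" using ij by (simp add: c_def)
  finally have "c i = 0" using assms(2) ij unfolding frame_def by blast
  then show False by (simp add: c_def)
qed

lemma frame_iff_independent:
  assumes "finite I"
  shows "frame I y \<longleftrightarrow> inj_on y I \<and> independent (y ` I)"
proof
  assume fr: "frame I y"
  have inj: "inj_on y I" using frame_inj_on[OF assms fr] .
  have "independent (y ` I)"
  proof (rule independent_if_scalars_zero)
    fix u v assume z: "(\<Sum>x\<in>y ` I. u x *\<^sub>R x) = 0" and v: "v \<in> y ` I"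
    have "(\<Sum>i\<in>I. u (y i) *\<^sub>R y i) = 0" using z by (simp add: sum.reindex[OF inj])
    then have "\<forall>i\<in>I. u (y i) = 0" using fr unfolding frame_def by (elim allE[of _ "\<lambda>i. u (y i)"]) simp
    then show "u v = 0" using v by blast
  qed (use assms in simp)
  with inj show "inj_on y I \<and> independent (y ` I)" by simp
next
  assume h: "inj_on y I \<and> independent (y ` I)"
  show "frame I y"
    unfolding frame_def
  proof (intro allI impI ballI)
    fix c i assume z: "(\<Sum>i\<in>I. c i *\<^sub>R y i) = 0" and i: "i \<in> I"
    define u where "u v = c (the_inv_into I y v)" for v
    have "(\<Sum>x\<in>y ` I. u x *\<^sub>R x) = (\<Sum>i\<in>I. c i *\<^sub>R y i)"
      using h by (subst sum.reindex) (auto simp: u_def the_inv_into_f_f intro!: sum.cong)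
    then have "u (y i) = 0"
      using z h i assms independentD[of "y ` I" "y ` I" u "y i"] by auto
    then show "c i = 0" using h i by (simp add: u_def the_inv_into_f_f)
  qed
qed

lemma span_family:
  assumes "finite I" "x \<in> span (y ` I)"
  obtains c where "x = (\<Sum>i\<in>I. c i *\<^sub>R y i)"
proof -
  let ?S = "{x. \<exists>c. x = (\<Sum>i\<in>I. c i *\<^sub>R y i)}"
  have "subspace ?S"
  proof (rule subspaceI)
    show "0 \<in> ?S" by (auto intro!: exI[of _ "\<lambda>_. 0"])
    fix a b assume "a \<in> ?S" "b \<in> ?S"
    then obtain c d where "a = (\<Sum>i\<in>I. c i *\<^sub>R y i)" "b = (\<Sum>i\<in>I. d i *\<^sub>R y i)" by auto
    then have "a + b = (\<Sum>i\<in>I. (c i + d i) *\<^sub>R y i)" by (simp add: sum.distrib scaleR_left_distrib)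
    then show "a + b \<in> ?S" by auto
  next
    fix r a assume "a \<in> ?S"
    then obtain c where "a = (\<Sum>i\<in>I. c i *\<^sub>R y i)" by auto
    then have "r *\<^sub>R a = (\<Sum>i\<in>I. (r * c i) *\<^sub>R y i)" by (simp add: scaleR_sum_right)
    then show "r *\<^sub>R a \<in> ?S" by auto
  qed
  moreover have "y ` I \<subseteq> ?S"
  proof
    fix v assume "v \<in> y ` I"
    then obtain j where j: "j \<in> I" "v = y j" by auto
    have "v = (\<Sum>i\<in>I. (if i = j then 1 else 0) *\<^sub>R y i)"
      using j assms(1) by (simp add: if_distrib[of "\<lambda>r. r *\<^sub>R _"] sum.delta cong: if_cong)
    then show "v \<in> ?S" by (intro CollectI exI)
  qed
  ultimately have "span (y ` I) \<subseteq> ?S" by (simp add: span_minimal)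
  then show ?thesis using assms(2) that by auto
qed

lemma det_rows_frame:
  fixes M :: "real^'d^'d"
  shows "det M \<noteq> 0 \<longleftrightarrow> frame UNIV (\<lambda>i. M $ i)"
proof -
  have "det M \<noteq> 0 \<longleftrightarrow> (\<exists>B. M ** B = mat 1)"
    by (metis invertible_det_nz invertible_right_inverse)
  also have "\<dots> \<longleftrightarrow> frame UNIV (\<lambda>i. M $ i)"
    unfolding matrix_right_invertible_independent_rows frame_def
    by (simp add: row_def scalar_mult_eq_scaleR vec_nth_inverse)
  finally show ?thesis .
qed

text \<open>Steinitz exchange with the standard basis; in other words, an independent family has a
  nonzero maximal minor.\<close>

lemma frame_extend:
  fixes y :: "'d \<Rightarrow> real^'d"
  assumes "frame I y"
  obtains f where "range f \<subseteq> Basis" "det (ext I y f) \<noteq> 0"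
proof -
  have inj: "inj_on y I" and ind: "independent (y ` I)"
    using assms frame_iff_independent[of I y] by auto
  obtain B where B: "y ` I \<subseteq> B" "B \<subseteq> y ` I \<union> Basis" "independent B" "y ` I \<union> Basis \<subseteq> span B"
    using maximal_independent_subset_extend[of "y ` I" "y ` I \<union> Basis"] ind by auto
  have "span B = UNIV"
    by (metis B(4) Un_subset_iff span_Basis span_mono span_span top.extremum_unique)
  then have cB: "card B = CARD('d)" and fB: "finite B"
    using B(3) independent_bound[of B] dim_eq_card[of B UNIV] by (auto simp: dim_UNIV)
  have "card (B - y ` I) = card (- I)"
    using B(1) fB cB inj by (simp add: card_Diff_subset card_image Compl_eq_Diff_UNIV finite_subset)
  then obtain f0 where f0: "bij_betw f0 (- I) (B - y ` I)"
    using fB by (metis finite_Diff finite finite_same_card_bij)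
  \<comment> \<open>A default on \<open>I\<close>, where \<open>ext\<close> reads \<open>y\<close>;
    it keeps \<open>range f\<close> inside \<open>Basis\<close>.\<close>
  define b :: "real^'d" where "b = (SOME b. b \<in> Basis)"
  have b: "b \<in> Basis" unfolding b_def by (simp add: some_in_eq nonempty_Basis)
  define f where "f i = (if i \<in> I then b else f0 i)" for i
  have fBasis: "range f \<subseteq> Basis"
    using b f0 B(2) by (auto simp: f_def bij_betw_def)
  let ?g = "\<lambda>i. ext I y f $ i"
  have g: "?g i = (if i \<in> I then y i else f0 i)" for i by (simp add: ext_def f_def)
  have "bij_betw ?g I (y ` I)"
    using inj by (auto simp: bij_betw_def inj_on_def g)
  moreover have "bij_betw ?g (- I) (B - y ` I)"
    using f0 by (subst bij_betw_cong[of _ _ f0]) (simp_all add: g)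
  ultimately have "bij_betw ?g (I \<union> - I) (y ` I \<union> (B - y ` I))"
    by (rule bij_betw_combine) auto
  then have "bij_betw ?g UNIV B" using B(1) by (simp add: Un_absorb1)
  then have "frame UNIV ?g" using B(3) frame_iff_independent[of UNIV ?g] by (simp add: bij_betw_def)
  then have "det (ext I y f) \<noteq> 0" by (simp add: det_rows_frame)
  then show ?thesis using that[of f] fBasis by simp
qed

text \<open>The factor is the determinant of the coefficients of \<open>y'\<close> over
  \<open>y\<close>, completed by identity rows outside \<open>I\<close>, so neither \<open>T\<close>
  nor \<open>f\<close> enters. This uniformity allows two frames of one subspace to be compared
  after any linear map and in every minor at once.\<close>

lemma det_ext_change_frame:
  fixes y y' :: "'d \<Rightarrow> real^'d"
  assumes "y' ` I \<subseteq> span (y ` I)"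
  shows "\<exists>s. \<forall>T f. det (ext I (\<lambda>i. T *v y' i) f) = s * det (ext I (\<lambda>i. T *v y i) f)"
proof -
  have "\<exists>c. y' i = (\<Sum>l\<in>I. c l *\<^sub>R y l)" if "i \<in> I" for i
    using span_family[OF finite, of "y' i" y I] assms that by blast
  then have "\<forall>i. \<exists>c. i \<in> I \<longrightarrow> y' i = (\<Sum>l\<in>I. c l *\<^sub>R y l)" by blast
  from choice[OF this] obtain C where C: "\<And>i. i \<in> I \<Longrightarrow> y' i = (\<Sum>l\<in>I. C i l *\<^sub>R y l)" by blast
  define K :: "real^'d^'d" where
    "K = (\<chi> i l. if i \<in> I then if l \<in> I then C i l else 0 else if l = i then 1 else 0)"
  have "ext I (\<lambda>i. T *v y' i) f = K ** ext I (\<lambda>i. T *v y i) f" for T f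
  proof -
    have "ext I (\<lambda>i. T *v y' i) f $ i $ j = (K ** ext I (\<lambda>i. T *v y i) f) $ i $ j" for i j
    proof (cases "i \<in> I")
      case True
      have "(K ** ext I (\<lambda>i. T *v y i) f) $ i $ j = (\<Sum>l\<in>UNIV. if l \<in> I then C i l * (T *v y l) $ j else 0)"
        using True by (auto simp: matrix_matrix_mult_def K_def ext_def intro!: sum.cong)
      also have "\<dots> = (\<Sum>l\<in>I. C i l * (T *v y l) $ j)" by (simp add: sum.If_cases)
      also have "\<dots> = (T *v y' i) $ j"
        by (simp add: C[OF True] linear_sum[OF matrix_vector_mul_linear]
            linear_cmul[OF matrix_vector_mul_linear])
      finally show ?thesis using True by (simp add: ext_def)
    next
      case False
      then show ?thesis
        by (simp add: matrix_matrix_mult_def K_def ext_def if_distrib[of "\<lambda>x. x * _"] sum.delta' cong: if_cong)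
    qed
    then show ?thesis by (simp add: vec_eq_iff)
  qed
  then have "det (ext I (\<lambda>i. T *v y' i) f) = det K * det (ext I (\<lambda>i. T *v y i) f)" for T f
    by (simp add: det_mul)
  then show ?thesis by blast
qed

lemma det_ext_scale_rows:
  "det (ext I (\<lambda>i. a i *\<^sub>R y i) f) = (\<Prod>i\<in>I. a i) * det (ext I y f)"
proof -
  have "ext I (\<lambda>i. a i *\<^sub>R y i) f = (\<chi> i. (if i \<in> I then a i else 1) *s (ext I y f $ i))"
    by (simp add: ext_def vec_eq_iff)
  then have "det (ext I (\<lambda>i. a i *\<^sub>R y i) f) = (\<Prod>i\<in>UNIV. if i \<in> I then a i else 1) * det (\<chi> i. ext I y f $ i)"
    by (simp add: det_rows_mul)
  then show ?thesis by (simp add: prod.If_cases)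
qed

lemma tendsto_det:
  fixes M :: "'a \<Rightarrow> real^'d^'d"
  assumes "(M \<longlongrightarrow> L) F"
  shows "((\<lambda>x. det (M x)) \<longlongrightarrow> det L) F"
  unfolding det_def by (intro tendsto_intros assms)

lemma tendsto_det_ext:
  fixes y :: "'a \<Rightarrow> 'd \<Rightarrow> real^'d"
  assumes "\<And>i. i \<in> I \<Longrightarrow> ((\<lambda>x. y x i) \<longlongrightarrow> l i) F"
  shows "((\<lambda>x. det (ext I (y x) f)) \<longlongrightarrow> det (ext I l f)) F"
  unfolding ext_def using assms by (intro tendsto_det vec_tendstoI) (auto intro: tendsto_vec_nth)

text \<open>With determinant one, Cramer's rule writes the solution as a polynomial in the entries
  of the matrix.\<close>

lemma tendsto_transpose_solution:
  fixes G :: "'a \<Rightarrow> real^'d^'d"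
  assumes "(G \<longlongrightarrow> g) F" "\<And>k. det (G k) = 1" "det g = 1" "\<And>k. transpose (G k) *v \<phi> k = z" "transpose g *v \<psi> = z"
  shows "(\<phi> \<longlongrightarrow> \<psi>) F"
proof -
  have sol: "x = (\<chi> k. det (\<chi> i j. if j = k then z $ i else transpose M $ i $ j))"
    if "det M = 1" "transpose M *v x = z" for M :: "real^'d^'d" and x
    using cramer[of "transpose M" x z] that by (simp add: det_transpose)
  have "\<phi> = (\<lambda>x. \<chi> k. det (\<chi> i j. if j = k then z $ i else transpose (G x) $ i $ j))"
    using sol[OF assms(2,4)] by blast
  moreover have "\<psi> = (\<chi> k. det (\<chi> i j. if j = k then z $ i else transpose g $ i $ j))"
    using sol[OF assms(3,5)] .
  moreover have "((\<lambda>x. \<chi> k. det (\<chi> i j. if j = k then z $ i else transpose (G x) $ i $ j))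
     \<longlongrightarrow> (\<chi> k. det (\<chi> i j. if j = k then z $ i else transpose g $ i $ j))) F"
    by (intro tendsto_vec_lambda tendsto_det) 
       (auto simp: transpose_def intro!: tendsto_vec_lambda tendsto_vec_nth assms(1))
  ultimately show ?thesis by simp
qed

section \<open>Block coordinates and the diagonal flow\<close>

definition vfst :: "real^('m::finite + 'n::finite) \<Rightarrow> real^'m" where "vfst v = (\<chi> a. v $ Inl a)"
definition vsnd :: "real^('m::finite + 'n::finite) \<Rightarrow> real^'n" where "vsnd v = (\<chi> b. v $ Inr b)"
definition vpair :: "real^'m \<Rightarrow> real^'n \<Rightarrow> real^('m::finite + 'n::finite)" where
  "vpair u w = (\<chi> i. case i of Inl a \<Rightarrow> u $ a | Inr b \<Rightarrow> w $ b)"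

lemma vpair_nth [simp]: "vpair u w $ Inl a = u $ a" "vpair u w $ Inr b = w $ b"
  by (simp_all add: vpair_def)

lemma vfst_nth [simp]: "vfst v $ a = v $ Inl a" and vsnd_nth [simp]: "vsnd v $ b = v $ Inr b"
  by (simp_all add: vfst_def vsnd_def)

lemma vec_sum_eq_iff: "v = w \<longleftrightarrow> (\<forall>a. v $ Inl a = w $ Inl a) \<and> (\<forall>b. v $ Inr b = w $ Inr b)"
  for v w :: "'a^('m::finite + 'n::finite)"
  by (metis sum.exhaust vec_eq_iff)

lemma vfst_vpair [simp]: "vfst (vpair u w) = u" and vsnd_vpair [simp]: "vsnd (vpair u w) = w"
  and vpair_fst_snd [simp]: "vpair (vfst v) (vsnd v) = v"
  by (simp_all add: vec_eq_iff[of "vfst _"] vec_eq_iff[of "vsnd _"] vec_sum_eq_iff[of _ v])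

lemma linear_vfst: "linear vfst" and linear_vsnd: "linear vsnd"
  by (auto intro!: linearI simp: vec_eq_iff)

lemmas vfst_simps [simp] = linear_add[OF linear_vfst] linear_diff[OF linear_vfst]
  linear_cmul[OF linear_vfst] linear_0[OF linear_vfst] linear_neg[OF linear_vfst]
lemmas vsnd_simps [simp] = linear_add[OF linear_vsnd] linear_diff[OF linear_vsnd]
  linear_cmul[OF linear_vsnd] linear_0[OF linear_vsnd] linear_neg[OF linear_vsnd]

lemma sum_UNIV_Plus:
  "(\<Sum>i\<in>UNIV. f i) = (\<Sum>a\<in>UNIV. f (Inl a)) + (\<Sum>b\<in>UNIV. f (Inr b))"
  for f :: "'m::finite + 'n::finite \<Rightarrow> real"
  using sum.Plus[of UNIV UNIV f] by (simp add: UNIV_Plus_UNIV)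

lemma tendsto_vpair:
  "(f \<longlongrightarrow> a) F \<Longrightarrow> (g \<longlongrightarrow> b) F \<Longrightarrow> ((\<lambda>x. vpair (f x) (g x)) \<longlongrightarrow> vpair a b) F"
proof (rule vec_tendstoI)
  fix i assume "(f \<longlongrightarrow> a) F" "(g \<longlongrightarrow> b) F"
  then show "((\<lambda>x. vpair (f x) (g x) $ i) \<longlongrightarrow> vpair a b $ i) F"
    by (cases i) (auto intro: tendsto_vec_nth)
qed

lemma tendsto_vsnd: "(f \<longlongrightarrow> a) F \<Longrightarrow> ((\<lambda>x. vsnd (f x)) \<longlongrightarrow> vsnd a) F"
  by (rule vec_tendstoI, simp only: vsnd_nth, erule tendsto_vec_nth)

lemma block_matrix_mult:
  "block_matrix P Q R S *v v = vpair (P *v vfst v + Q *v vsnd v) (R *v vfst v + S *v vsnd v)"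
  by (auto simp: vec_sum_eq_iff[of _ "vpair _ _"] block_matrix_def matrix_vector_mult_def sum_UNIV_Plus)

lemma mat_mult_scaleR: "mat c *v v = c *\<^sub>R (v::real^'k)"
  by (auto simp: vec_eq_iff mat_def matrix_vector_mult_def if_distrib[of "\<lambda>x. x * _"] sum.delta cong: if_cong)

lemma flow_mult:
  fixes v :: "real^('m::finite + 'n::finite)"
  shows "flow t *v v = vpair (exp (real CARD('n) * t) *\<^sub>R vfst v) (exp (- real CARD('m) * t) *\<^sub>R vsnd v)"
  by (simp add: flow_def block_matrix_mult mat_mult_scaleR)

lemma flow_add: "flow s ** flow t = (flow (s + t) :: real^('m::finite + 'n::finite)^('m + 'n))"
proof -
  have "(flow s ** flow t) *v v = flow (s + t) *v v" for v :: "real^('m + 'n)"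
    by (simp flip: matrix_vector_mul_assoc add: flow_mult algebra_simps flip: exp_add)
  then show ?thesis by (simp add: matrix_eq)
qed

lemma flow_0: "flow 0 = mat 1"
  by (simp add: matrix_eq flow_mult)

lemma flow_inverse: "flow t ** flow (- t) = mat 1" "flow (- t) ** flow t = mat 1"
  by (simp_all add: flow_add flow_0)

lemma transpose_flow [simp]: "transpose (flow t) = flow t"
  unfolding flow_def block_matrix_def transpose_def
  by (auto simp: vec_eq_iff mat_def split: sum.split)

section \<open>Integral unimodular matrices\<close>

text \<open>Membership in GL(d, Z), encoded as stabilizing the integer lattice, so that two bases of
  one lattice differ by such a matrix at once.\<close>

definition unimod :: "real^'d^'d \<Rightarrow> bool" where
  "unimod N \<longleftrightarrow> invertible N \<and> act N int_vecs = int_vecs"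

lemma unimod_int: "unimod N \<Longrightarrow> v \<in> int_vecs \<Longrightarrow> N *v v \<in> int_vecs"
  unfolding unimod_def act_def by blast

lemma act_act: "act M (act N X) = act (M ** N) X"
  by (simp add: act_def image_image matrix_vector_mul_assoc)

lemma act_mat_1 [simp]: "act (mat 1) X = X"
  by (simp add: act_def)

lemma unimod_mat_1: "unimod (mat 1)"
  by (auto simp: unimod_def invertible_def intro!: exI[of _ "mat 1"])

lemma unimod_mult: "unimod M \<Longrightarrow> unimod N \<Longrightarrow> unimod (M ** N)"
  by (simp add: unimod_def invertible_mult flip: act_act)

lemma unimod_inverse:
  assumes "unimod N"
  obtains N' where "unimod N'" "N ** N' = mat 1" "N' ** N = mat 1"
proof -
  obtain N' where N': "N ** N' = mat 1" "N' ** N = mat 1"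
    using assms by (auto simp: unimod_def invertible_def)
  have "act N' int_vecs = act N' (act N int_vecs)" using assms by (simp add: unimod_def)
  also have "\<dots> = int_vecs" by (simp add: act_act N')
  finally have "unimod N'" using N' by (auto simp: unimod_def invertible_def)
  then show ?thesis using that N' by blast
qed

lemma unimod_entry_Ints:
  assumes "unimod N" shows "N $ i $ j \<in> \<int>"
proof -
  have "axis j 1 \<in> int_vecs" by (auto simp: int_vecs_def axis_def)
  then have "N *v axis j 1 \<in> int_vecs" using assms by (rule unimod_int[rotated])
  moreover have "(N *v axis j 1) $ i = N $ i $ j"
    by (simp add: matrix_vector_mult_basis column_def)
  ultimately show ?thesis by (metis int_vecs_def mem_Collect_eq)
qed

lemma int_vecs_diff: "a \<in> int_vecs \<Longrightarrow> b \<in> int_vecs \<Longrightarrow> a - b \<in> int_vecs"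
  by (simp add: int_vecs_def)

lemma int_matrix_mult: "(\<And>i j. N $ i $ j \<in> \<int>) \<Longrightarrow> v \<in> int_vecs \<Longrightarrow> N *v v \<in> int_vecs"
  by (auto simp: int_vecs_def matrix_vector_mult_def intro!: Ints_sum Ints_mult)

text \<open>Integrality of the entries of \<open>N\<close> and of its inverse survives
  transposition. Coordinates in the dual lattice change by these transposes.\<close>

lemma unimod_transpose:
  assumes "unimod N" shows "unimod (transpose N)"
proof -
  obtain N' where N': "unimod N'" "N ** N' = mat 1" "N' ** N = mat 1"
    using unimod_inverse[OF assms] .
  have 1: "transpose N ** transpose N' = mat 1" "transpose N' ** transpose N = mat 1"
    using N' by (simp_all flip: matrix_transpose_mul)
  have int: "transpose M *v v \<in> int_vecs" if "unimod M" "v \<in> int_vecs" for M :: "real^'a^'a" and v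
    using that by (intro int_matrix_mult) (auto simp: transpose_def unimod_entry_Ints)
  have "v \<in> act (transpose N) int_vecs" if "v \<in> int_vecs" for v
  proof -
    have "v = transpose N *v (transpose N' *v v)" by (metis 1(1) matrix_vector_mul_assoc matrix_vector_mul_lid)
    then show ?thesis using int[OF N'(1) that] by (auto simp: act_def)
  qed
  then have "act (transpose N) int_vecs = int_vecs"
    using int[OF assms] by (auto simp: act_def)
  then show ?thesis using 1 by (auto simp: unimod_def invertible_def)
qed

lemma det_Ints:
  fixes M :: "real^'d^'d"
  assumes "\<And>i j. M $ i $ j \<in> \<int>"
  shows "det M \<in> \<int>"
  unfolding det_def using assms by (auto intro!: Ints_sum Ints_mult Ints_prod)

lemma det_ext_Ints:
  assumes "\<And>i. i \<in> I \<Longrightarrow> y i \<in> int_vecs" "range f \<subseteq> Basis"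
  shows "det (ext I y f) \<in> \<int>"
proof (rule det_Ints)
  fix i j
  have "f i \<in> Basis" using assms by blast
  then have "f i $ j \<in> \<int>" by (auto simp: Basis_vec_def axis_def)
  then show "ext I y f $ i $ j \<in> \<int>" using assms(1) by (auto simp: ext_def int_vecs_def)
qed

section \<open>Volume growth under the flow\<close>

lemma frame_mult:
  fixes T :: "real^'d^'d"
  assumes "invertible T" "frame I y"
  shows "frame I (\<lambda>i. T *v y i)"
  unfolding frame_def
proof (intro allI impI)
  fix c assume "(\<Sum>i\<in>I. c i *\<^sub>R (T *v y i)) = 0"
  then have "T *v (\<Sum>i\<in>I. c i *\<^sub>R y i) = 0"
    by (simp add: linear_sum[OF matrix_vector_mul_linear] linear_cmul[OF matrix_vector_mul_linear])
  moreover obtain T' where "T' ** T = mat 1" using assms(1) by (auto simp: invertible_def)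
  ultimately have "(\<Sum>i\<in>I. c i *\<^sub>R y i) = 0"
    by (metis matrix_vector_mul_assoc matrix_vector_mul_lid matrix_vector_mult_0_right)
  then show "\<forall>i\<in>I. c i = 0" using assms(2) unfolding frame_def by blast
qed

text \<open>\<open>J\<close> indexes a basis of the intersection with the directions that \<open>flow (- t)\<close> contracts; the
  last family is the limit of the rescaled images of \<open>w\<close> under \<open>flow (- t)\<close>.\<close>

lemma adapted_frame:
  fixes y :: "('m::finite + 'n::finite) \<Rightarrow> real^('m + 'n)"
  assumes "frame I y"
  obtains w J where "y ` I \<subseteq> span (w ` I)" "J \<subseteq> I" "w ` J \<subseteq> {v. vsnd v = 0}"
    "frame I (\<lambda>i. if i \<in> J then w i else vpair 0 (vsnd (w i)))"
proof -
  let ?W = "span (y ` I)" and ?W1 = "span (y ` I) \<inter> {v. vsnd v = 0}"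
  have inj: "inj_on y I" and ind: "independent (y ` I)"
    using assms frame_iff_independent[of I y] by auto
  obtain B1 where B1: "B1 \<subseteq> ?W1" "independent B1" "?W1 \<subseteq> span B1"
    using maximal_independent_subset[of ?W1] by blast
  obtain B where B: "B1 \<subseteq> B" "B \<subseteq> ?W" "independent B" "?W \<subseteq> span B"
    using maximal_independent_subset_extend[of B1 ?W] B1 by auto
  have "card B = dim ?W" using B(2-4) by (simp add: basis_card_eq_dim)
  also have "\<dots> = card I" using ind inj by (simp add: dim_eq_card_independent card_image)
  finally obtain w where w: "bij_betw w I B"
    using B(3) finiteI_independent by (metis finite finite_same_card_bij)
  define J where "J = {i \<in> I. w i \<in> B1}"
  have wI: "w ` I = B" and winj: "inj_on w I" using w by (auto simp: bij_betw_def)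
  have wJ: "w ` J = B1" using wI B(1) by (auto simp: J_def)
  have frw: "frame I w" using frame_iff_independent[of I w] wI winj B(3) by simp
  have "frame I (\<lambda>i. if i \<in> J then w i else vpair 0 (vsnd (w i)))"
    unfolding frame_def
  proof (intro allI impI)
    fix c assume z: "(\<Sum>i\<in>I. c i *\<^sub>R (if i \<in> J then w i else vpair 0 (vsnd (w i)))) = 0"
    have split: "(\<Sum>i\<in>I. h i) = (\<Sum>i\<in>J. h i) + (\<Sum>i\<in>I-J. h i)" for h :: "_ \<Rightarrow> real^('m+'n)"
      using sum.subset_diff[of J I h] by (simp add: J_def add.commute)
    have s: "vsnd (w i) = 0" if "i \<in> J" for i using that wJ B1(1) by auto
    \<comment> \<open>A relation among the limit vectors forces \<open>vsnd v = 0\<close>, so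
      \<open>v\<close> is a combination over \<open>J\<close>; this turns it into a relation among
      the \<open>w i\<close> themselves.\<close>
    define v where "v = (\<Sum>i\<in>I-J. c i *\<^sub>R w i)"
    have "0 = vsnd (\<Sum>i\<in>I. c i *\<^sub>R (if i \<in> J then w i else vpair 0 (vsnd (w i))))"
      by (simp add: z)
    also have "\<dots> = (\<Sum>i\<in>I. c i *\<^sub>R vsnd (w i))"
      by (auto simp: linear_sum[OF linear_vsnd] s intro!: sum.cong)
    also have "\<dots> = (\<Sum>i\<in>I-J. c i *\<^sub>R vsnd (w i))"
      by (rule sum.mono_neutral_right) (auto simp: s)
    also have "\<dots> = vsnd v" by (simp add: v_def linear_sum[OF linear_vsnd])
    finally have "vsnd v = 0" by simp
    moreover have "v \<in> ?W" unfolding v_def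
      using wI B(2) by (intro span_sum span_scale) auto
    ultimately have "v \<in> span (w ` J)" using B1(3) wJ by auto
    then obtain e where e: "v = (\<Sum>i\<in>J. e i *\<^sub>R w i)" using span_family[of J v w] by auto
    have "(\<Sum>i\<in>I. (if i \<in> J then - e i else c i) *\<^sub>R w i) = 0"
      unfolding split using e by (simp add: v_def sum_negf)
    then have "\<forall>i\<in>I. (if i \<in> J then - e i else c i) = 0" 
      using frw unfolding frame_def by (elim allE[of _ "\<lambda>i. if i \<in> J then - e i else c i"]) simp
    then have c0: "c i = 0" if "i \<in> I - J" for i using that by auto
    have "(\<Sum>i\<in>I. c i *\<^sub>R w i) = (\<Sum>i\<in>I. c i *\<^sub>R (if i \<in> J then w i else vpair 0 (vsnd (w i))))"
      using c0 by (intro sum.cong) auto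
    then show "\<forall>i\<in>I. c i = 0"
      using z frw unfolding frame_def by (elim allE[of _ c]) simp
  qed
  moreover have "y ` I \<subseteq> span (w ` I)"
    using B(4) wI span_superset[of "y ` I"] by auto
  moreover have "w ` J \<subseteq> {v. vsnd v = 0}" using wJ B1(1) by auto
  ultimately show ?thesis using that[of w J] by (simp add: J_def)
qed

text \<open>Otherwise \<open>m + n\<close> would divide \<open>m (i + j)\<close> and hence \<open>i + j\<close>.\<close>

lemma coprime_exponent_nonzero:
  fixes m n i j :: nat
  assumes "coprime m n" "0 < i + j" "i + j < m + n"
  shows "m * j \<noteq> n * i"
proof
  assume eq: "m * j = n * i"
  have "m * (i + j) = (m + n) * i" using eq by (simp add: algebra_simps)
  then have "m + n dvd m * (i + j)" by simp
  moreover have "coprime (m + n) m" using assms(1) by (metis coprime_iff_gcd_eq_1 gcd_add2 gcd.commute)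
  ultimately have "m + n dvd i + j" by (simp add: coprime_dvd_mult_right_iff)
  then show False using assms(2,3) by (simp add: nat_dvd_not_less)
qed

text \<open>Dividing each vector of the adapted frame by its own rate \<open>a t i\<close> leaves a
  family converging to a frame. Every minor is thus \<open>exp (e * t)\<close> times a convergent
  factor, nonzero in the limit for some \<open>f\<close>. Coprimality gives
  \<open>e \<noteq> 0\<close>, and its sign selects the alternative.\<close>

lemma flow_frame_volume:
  fixes y :: "('m::finite + 'n::finite) \<Rightarrow> real^('m + 'n)"
  assumes cop: "coprime CARD('m) CARD('n)" and I: "I \<noteq> {}" "I \<noteq> UNIV" and fr: "frame I y"
  shows "(\<forall>f. ((\<lambda>t. det (ext I (\<lambda>i. flow (- t) *v y i) f)) \<longlongrightarrow> 0) at_top) \<or>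
    (\<exists>f. filterlim (\<lambda>t. \<bar>det (ext I (\<lambda>i. flow (- t) *v y i) f)\<bar>) at_top at_top)"
proof -
  let ?m = "real CARD('m)" and ?n = "real CARD('n)"
  obtain w J where w: "y ` I \<subseteq> span (w ` I)" and J: "J \<subseteq> I" "w ` J \<subseteq> {v. vsnd v = 0}"
    and frb: "frame I (\<lambda>i. if i \<in> J then w i else vpair 0 (vsnd (w i)))"
    using adapted_frame[OF fr] .
  have J2: "vsnd (w i) = 0" if "i \<in> J" for i using J(2) that by blast
  obtain s where s: "\<forall>T f. det (ext I (\<lambda>i. T *v y i) f) = s * det (ext I (\<lambda>i. T *v w i) f)"
    using det_ext_change_frame[OF w] by blast
  obtain f0 where "det (ext I y f0) \<noteq> 0" using frame_extend[OF fr] .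
  then have "s \<noteq> 0" using s[THEN spec, of "mat 1"] by auto
  define e where "e = ?m * real (card (I - J)) - ?n * real (card J)"
  have "card J + card (I - J) = card I" using J(1) by (simp add: card_Diff_subset card_mono)
  moreover have "card I < CARD('m) + CARD('n)" "0 < card I"
    using I psubset_card_mono[of UNIV I] by (auto simp: card_gt_0_iff)
  ultimately have "CARD('m) * card (I - J) \<noteq> CARD('n) * card J"
    using coprime_exponent_nonzero[OF cop, of "card J" "card (I - J)"] by simp
  then have e0: "e \<noteq> 0" unfolding e_def by (metis eq_iff_diff_eq_0 of_nat_eq_iff of_nat_mult)
  define b where "b t i = (if i \<in> J then w i else vpair (exp (- (?m + ?n) * t) *\<^sub>R vfst (w i)) (vsnd (w i)))" for t i
  define a where "a t i = (if i \<in> J then exp (- ?n * t) else exp (?m * t))" for t i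
  have fl: "flow (- t) *v w i = a t i *\<^sub>R b t i" if "i \<in> I" for t i
    using J2[of i] unfolding flow_mult a_def b_def
    by (auto simp: vec_sum_eq_iff[of "vpair _ _"] algebra_simps simp flip: exp_add)
       (metis vfst_nth vsnd_nth vec_eq_iff zero_index)+
  have "(\<Prod>i\<in>I. a t i) = exp (e * t)" for t
  proof -
    have "(\<Prod>i\<in>I. a t i) = (\<Prod>i\<in>J. a t i) * (\<Prod>i\<in>I - J. a t i)"
      using prod.subset_diff[of J I "a t"] J(1) by (simp add: mult.commute)
    also have "(\<Prod>i\<in>J. a t i) = exp (- ?n * t) ^ card J" by (simp add: a_def)
    also have "(\<Prod>i\<in>I - J. a t i) = exp (?m * t) ^ card (I - J)" by (simp add: a_def)
    finally show ?thesis
      by (simp add: e_def algebra_simps flip: exp_of_nat_mult exp_add)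
  qed
  moreover have "ext I (\<lambda>i. flow (- t) *v w i) f = ext I (\<lambda>i. a t i *\<^sub>R b t i) f" for t f
    by (simp add: ext_def vec_eq_iff fl)
  ultimately have vol: "det (ext I (\<lambda>i. flow (- t) *v y i) f) = s * exp (e * t) * det (ext I (b t) f)" for t f
    by (simp add: s det_ext_scale_rows)
  let ?b = "\<lambda>i. if i \<in> J then w i else vpair 0 (vsnd (w i))"
  have "0 < ?m" "0 < ?n" by simp_all
  then have neg: "- (?m + ?n) < 0" by linarith
  have "((\<lambda>t. exp (- (?m + ?n) * t)) \<longlongrightarrow> 0) at_top"
    by (intro filterlim_compose[OF exp_at_bot] filterlim_tendsto_neg_mult_at_bot[OF tendsto_const neg] filterlim_ident)
  then have "((\<lambda>t. exp (- (?m + ?n) * t) *\<^sub>R vfst (w i)) \<longlongrightarrow> 0 *\<^sub>R vfst (w i)) at_top" for i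
    by (intro tendsto_intros)
  then have "((\<lambda>t. b t i) \<longlongrightarrow> ?b i) at_top" for i
    unfolding b_def by (auto intro!: tendsto_vpair)
  then have lim: "((\<lambda>t. det (ext I (b t) f)) \<longlongrightarrow> det (ext I ?b f)) at_top" for f
    by (intro tendsto_det_ext)
  show ?thesis
  proof (cases "e < 0")
    case True
    then have "((\<lambda>t. exp (e * t)) \<longlongrightarrow> 0) at_top"
      by (intro filterlim_compose[OF exp_at_bot] filterlim_tendsto_neg_mult_at_bot[OF tendsto_const])
       (auto simp: filterlim_ident)
    then have "((\<lambda>t. s * exp (e * t) * det (ext I (b t) f)) \<longlongrightarrow> s * 0 * det (ext I ?b f)) at_top" for f
      by (intro tendsto_intros lim)
    then show ?thesis by (simp add: vol)
  next
    case False
    obtain f where f: "det (ext I ?b f) \<noteq> 0" using frame_extend[OF frb] .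
    have "filterlim (\<lambda>t. exp (e * t)) at_top at_top"
      using False e0 by (intro filterlim_compose[OF exp_at_top] filterlim_tendsto_pos_mult_at_top[OF tendsto_const])
       (auto simp: filterlim_ident)
    moreover have "((\<lambda>t. \<bar>s * det (ext I (b t) f)\<bar>) \<longlongrightarrow> \<bar>s * det (ext I ?b f)\<bar>) at_top"
      by (intro tendsto_intros lim)
    ultimately have "filterlim (\<lambda>t. \<bar>s * det (ext I (b t) f)\<bar> * exp (e * t)) at_top at_top"
      using f \<open>s \<noteq> 0\<close> by (intro filterlim_tendsto_pos_mult_at_top) auto
    then show ?thesis by (intro disjI2 exI[of _ f]) (simp add: vol abs_mult mult_ac)
  qed
qed

text \<open>Inverse transposes are dual bases, and \<open>h\<close> is the one of \<open>g\<close>.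
  Inverting and transposing \<open>G ** N = flow t ** g\<close> shows that the dual vector with
  coordinates \<open>transpose N *v z\<close> for \<open>g\<close> is carried by
  \<open>flow (- t)\<close> to the one with coordinates \<open>z\<close> for
  \<open>G\<close>.\<close>

lemma dual_coordinates:
  fixes g G N :: "real^('m::finite + 'n::finite)^('m + 'n)"
  assumes "G ** N = flow t ** g" "transpose g ** h = mat 1"
  shows "transpose G *v (flow (- t) *v (h *v (transpose N *v z))) = z"
proof -
  have "transpose N ** transpose G = transpose g ** flow t"
    using arg_cong[OF assms(1), of transpose] by (simp add: matrix_transpose_mul)
  then have "transpose N ** (transpose G ** (flow (- t) ** h)) = transpose g ** (flow t ** flow (- t)) ** h"
    by (simp add: matrix_mul_assoc)
  also have "\<dots> = mat 1" by (simp add: flow_inverse assms(2))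
  finally have "(transpose G ** (flow (- t) ** h)) ** transpose N = mat 1"
    by (simp add: matrix_left_right_inverse)
  then show ?thesis
    by (metis matrix_vector_mul_assoc matrix_vector_mul_lid)
qed

text \<open>\<open>Y\<close> and \<open>Z\<close> will be the zero-frequency vectors before and
  after an accumulation step. Without a drop in dimension, the predecessors of a basis of
  \<open>Z\<close> would at all late times span the one rational subspace \<open>span Y\<close>,
  with integral minors comparable to fixed ones, while their images under the dual flow converge to
  a frame. The flow would then neither expand nor contract the volume of that subspace.\<close>

lemma rank_drop:
  fixes g g' :: "real^('m::finite + 'n::finite)^('m + 'n)"
  assumes cop: "coprime CARD('m) CARD('n)" and g: "invertible g" and t: "filterlim t at_top sequentially"
    and N: "\<And>k. unimod (N k)" and G: "\<And>k. G k ** N k = flow (t k) ** g" "\<And>k. det (G k) = 1"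
      "G \<longlonglongrightarrow> g'" "det g' = 1"
    and Y: "Y \<subseteq> int_vecs" and Z: "\<And>z. z \<in> Z \<Longrightarrow> \<forall>\<^sub>F k in sequentially. transpose (N k) *v z \<in> Y"
    and dY: "dim Y < CARD('m) + CARD('n)"
  shows "dim Z < dim Y \<or> dim Z = 0"
proof (rule ccontr)
  assume "\<not> ?thesis"
  then have dZ: "dim Y \<le> dim Z" "0 < dim Z" by auto
  obtain B where B: "B \<subseteq> Z" "independent B" "Z \<subseteq> span B" "card B = dim Z"
    using basis_exists[of Z] .
  have fB: "finite B" using B(2) by (rule finiteI_independent)
  have "card B \<le> CARD('m + 'n)" using dim_subset_UNIV[of Z] by (simp add: B(4))
  then obtain I :: "('m + 'n) set" where cI: "card I = card B"
    using obtain_subset_with_card_n by metis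
  then obtain z where z: "bij_betw z I B"
    using fB by (metis finite finite_same_card_bij)
  have frz: "frame I z" using z B(2) by (subst frame_iff_independent) (auto simp: bij_betw_def)
  have zZ: "z i \<in> Z" if "i \<in> I" for i using z that B(1) by (auto simp: bij_betw_def)
  define y where "y k i = transpose (N k) *v z i" for k i
  have "\<forall>\<^sub>F k in sequentially. \<forall>i\<in>I. y k i \<in> Y"
    unfolding y_def using Z zZ by (intro eventually_ball_finite) auto
  then obtain K where K: "\<And>k i. k \<ge> K \<Longrightarrow> i \<in> I \<Longrightarrow> y k i \<in> Y"
    unfolding eventually_sequentially by blast
  have fry: "frame I (y k)" for k
    unfolding y_def using unimod_transpose[OF N] frz by (intro frame_mult) (auto simp: unimod_def)
  then have ind: "inj_on (y K) I" "independent (y K ` I)"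
    using frame_iff_independent[of I "y K"] by auto
  have cy: "card (y K ` I) = dim Z" using ind(1) by (simp add: card_image cI B(4))
  have sub: "y K ` I \<subseteq> Y" using K by auto
  have "dim (y K ` I) = dim Z" using ind(2) cy by (simp add: dim_eq_card_independent)
  then have "dim Z \<le> dim Y" using dim_subset[OF sub] by simp
  then have "card (y K ` I) = dim Y" using dZ cy by simp
  then have span: "Y \<subseteq> span (y K ` I)"
    using card_eq_dim[OF sub] ind(2) by simp
  have I: "I \<noteq> {}" "I \<noteq> UNIV"
  proof -
    have "0 < card I" "card I < CARD('m + 'n)"
      using dZ(2) cI B(4) dY \<open>dim Z \<le> dim Y\<close> by (simp_all only:) simp
    then show "I \<noteq> {}" "I \<noteq> UNIV" by auto
  qed
  have "\<exists>s. k \<ge> K \<longrightarrow> (\<forall>T f. det (ext I (\<lambda>i. T *v y k i) f) = s * det (ext I (\<lambda>i. T *v y K i) f))" for k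
  proof (cases "k \<ge> K")
    case True
    then have "y k ` I \<subseteq> span (y K ` I)" using K span by blast
    then show ?thesis using det_ext_change_frame by blast
  qed simp
  then have "\<forall>k. \<exists>s. k \<ge> K \<longrightarrow> (\<forall>T f. det (ext I (\<lambda>i. T *v y k i) f) = s * det (ext I (\<lambda>i. T *v y K i) f))"
    by blast
  from choice[OF this] obtain s where
    s: "\<And>k T f. k \<ge> K \<Longrightarrow> det (ext I (\<lambda>i. T *v y k i) f) = s k * det (ext I (\<lambda>i. T *v y K i) f)"
    by blast
  obtain e where e: "range e \<subseteq> Basis" "det (ext I (y K) e) \<noteq> 0" using frame_extend[OF fry] .
  define q where "q = \<bar>det (ext I (y K) e)\<bar>"
  have q: "q > 0" using e(2) by (simp add: q_def)
  have yint: "y k i \<in> int_vecs" if "k \<ge> K" "i \<in> I" for k i using K[OF that] Y by blast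
  have s0: "s k \<noteq> 0" if "k \<ge> K" for k
  proof -
    obtain f where "det (ext I (y k) f) \<noteq> 0" using frame_extend[OF fry] .
    then show ?thesis using s[OF that, of "mat 1" f] by auto
  qed
  \<comment> \<open>A nonzero integral minor has absolute value at least one.\<close>
  have lower: "1 \<le> \<bar>s k\<bar> * q" if k: "k \<ge> K" for k
  proof -
    have "det (ext I (y k) e) = s k * det (ext I (y K) e)" using s[OF k, of "mat 1" e] by simp
    moreover have "det (ext I (y k) e) \<in> \<int>" using yint[OF k] e(1) by (intro det_ext_Ints)
    ultimately show ?thesis
      using s0[OF k] e(2) Ints_nonzero_abs_ge1[of "det (ext I (y k) e)"] by (simp add: q_def abs_mult)
  qed
  \<comment> \<open>The reverse comparison: the integral matrix \<open>?T\<close> carries the late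
    frame back to \<open>y K\<close>, so the fixed integer \<open>det (ext I (y K) e)\<close> is
    \<open>s k\<close> times a nonzero integer.\<close>
  have upper: "\<bar>s k\<bar> \<le> q" if k: "k \<ge> K" for k
  proof -
    obtain N' where N': "unimod N'" "transpose (N k) ** N' = mat 1" "N' ** transpose (N k) = mat 1"
      using unimod_inverse[OF unimod_transpose[OF N]] .
    let ?T = "transpose (N K) ** N'"
    have T: "?T *v y k i = y K i" for i
      by (metis N'(3) y_def matrix_vector_mul_assoc matrix_vector_mul_lid)
    have "det (ext I (y K) e) = s k * det (ext I (\<lambda>i. ?T *v y K i) e)"
      using s[OF k, of ?T e] by (simp only: T)
    moreover have "unimod ?T" by (intro unimod_mult unimod_transpose N N'(1))
    then have "det (ext I (\<lambda>i. ?T *v y K i) e) \<in> \<int>"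
      using yint[of K] e(1) by (intro det_ext_Ints unimod_int) auto
    ultimately have "q = \<bar>s k\<bar> * \<bar>det (ext I (\<lambda>i. ?T *v y K i) e)\<bar>" 
      "1 \<le> \<bar>det (ext I (\<lambda>i. ?T *v y K i) e)\<bar>"
      using e(2) Ints_nonzero_abs_ge1[of "det (ext I (\<lambda>i. ?T *v y K i) e)"]
      by (auto simp: q_def abs_mult)
    then show ?thesis by (metis abs_ge_zero mult.right_neutral mult_left_mono)
  qed
  have "invertible (transpose g)" "invertible (transpose g')"
    using g G(4) by (auto simp: transpose_invertible invertible_det_nz)
  then obtain h h' where h: "transpose g ** h = mat 1" "h ** transpose g = mat 1"
    and h': "transpose g' ** h' = mat 1" by (auto simp: invertible_def)
  have frh: "frame I (\<lambda>i. h *v y K i)"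
    using h fry by (intro frame_mult) (auto simp: invertible_def)
  have lim: "(\<lambda>k. flow (- t k) *v (h *v y k i)) \<longlonglongrightarrow> h' *v z i" for i
  proof (rule tendsto_transpose_solution[OF G(3) G(2) G(4)])
    show "transpose (G k) *v (flow (- t k) *v (h *v y k i)) = z i" for k
      unfolding y_def by (rule dual_coordinates[OF G(1) h(1)])
    show "transpose g' *v (h' *v z i) = z i" by (simp add: matrix_vector_mul_assoc h' del: transpose_matrix_vector)
  qed
  have frz': "frame I (\<lambda>i. h' *v z i)"
    using h' matrix_left_right_inverse frz by (intro frame_mult) (auto simp: invertible_def)
  have limdet: "(\<lambda>k. det (ext I (\<lambda>i. flow (- t k) *v (h *v y k i)) f)) \<longlonglongrightarrow> det (ext I (\<lambda>i. h' *v z i) f)" for f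
    by (intro tendsto_det_ext lim)
  define D where "D f u = det (ext I (\<lambda>i. flow (- u) *v (h *v y K i)) f)" for f u
  have D: "\<forall>\<^sub>F k in sequentially. det (ext I (\<lambda>i. flow (- t k) *v (h *v y k i)) f) = s k * D f (t k)" for f
  proof -
    have "det (ext I (\<lambda>i. flow (- t k) *v (h *v y k i)) f) = s k * D f (t k)" if "k \<ge> K" for k
      using s[OF that, of "flow (- t k) ** h" f] unfolding D_def by (simp only: matrix_vector_mul_assoc)
    then show ?thesis unfolding eventually_sequentially by blast
  qed
  \<comment> \<open>As \<open>\<bar>s k\<bar>\<close> stays between \<open>1 / q\<close> and
    \<open>q\<close>, neither alternative is compatible with minors that converge to those of a
    frame.\<close>
  from flow_frame_volume[OF cop I frh] show False
  proof
    assume "\<forall>f. ((\<lambda>t. det (ext I (\<lambda>i. flow (- t) *v (h *v y K i)) f)) \<longlongrightarrow> 0) at_top"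
    then have "(D f \<longlongrightarrow> 0) at_top" for f unfolding D_def by simp
    then have "(\<lambda>k. D f (t k)) \<longlonglongrightarrow> 0" for f using t by (rule filterlim_compose)
    then have "(\<lambda>k. q * \<bar>D f (t k)\<bar>) \<longlonglongrightarrow> 0" for f
      by (simp add: tendsto_mult_right_zero tendsto_rabs_zero)
    then have "(\<lambda>k. s k * D f (t k)) \<longlonglongrightarrow> 0" for f
      by (rule Lim_null_comparison[rotated])
         (auto simp: eventually_sequentially abs_mult intro!: exI[of _ K] mult_right_mono upper)
    then have "(\<lambda>k. det (ext I (\<lambda>i. flow (- t k) *v (h *v y k i)) f)) \<longlonglongrightarrow> 0" for f
      by (rule Lim_transform_eventually) (use D[of f] in \<open>auto elim: eventually_mono\<close>)
    then have "det (ext I (\<lambda>i. h' *v z i) f) = 0" for f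
      using limdet LIMSEQ_unique by blast
    then show False using frame_extend[OF frz'] by metis
  next
    assume "\<exists>f. filterlim (\<lambda>t. \<bar>det (ext I (\<lambda>i. flow (- t) *v (h *v y K i)) f)\<bar>) at_top at_top"
    then obtain f where "filterlim (\<lambda>u. \<bar>D f u\<bar>) at_top at_top" unfolding D_def by blast
    then have "filterlim (\<lambda>k. \<bar>D f (t k)\<bar>) at_top sequentially"
      using t by (rule filterlim_compose)
    then have "filterlim (\<lambda>k. (1 / q) * \<bar>D f (t k)\<bar>) at_top sequentially"
      using q by (intro filterlim_tendsto_pos_mult_at_top[OF tendsto_const]) auto
    then have "filterlim (\<lambda>k. \<bar>det (ext I (\<lambda>i. flow (- t k) *v (h *v y k i)) f)\<bar>) at_top sequentially"
    proof (rule filterlim_at_top_mono)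
      have le: "1 / q * \<bar>D f (t k)\<bar> \<le> \<bar>s k\<bar> * \<bar>D f (t k)\<bar>" if "k \<ge> K" for k
        using lower[OF that] q by (intro mult_right_mono) (auto simp: field_simps)
      show "\<forall>\<^sub>F k in sequentially. 1 / q * \<bar>D f (t k)\<bar> \<le> \<bar>det (ext I (\<lambda>i. flow (- t k) *v (h *v y k i)) f)\<bar>"
        using D[of f] eventually_ge_at_top[of K] by eventually_elim (metis le abs_mult)
    qed
    then show False using not_tendsto_and_filterlim_at_infinity[OF _ limdet[of f, THEN tendsto_rabs]]
      by (meson filterlim_at_top_imp_at_infinity sequentially_bot)
  qed
qed

section \<open>Lifting convergence of lattices to convergence of bases\<close>

text \<open>The preimage of the image consists of the right translates of the open set by integral
  matrices of determinant one, and translation is continuous. Openness is what gives lattices near a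
  limit bases near a prescribed basis.\<close>

lemma lattice_map_open:
  assumes "open V"
  shows "openin lattice_top ((\<lambda>g. act g int_vecs) ` (SL \<inter> V))"
proof -
  let ?f = "\<lambda>g :: real^'d^'d. act g int_vecs"
  have "{x \<in> SL. ?f x \<in> ?f ` (SL \<inter> V)} = SL \<inter> (\<Union>N\<in>{N. unimod N \<and> det N = 1}. (\<lambda>x. x ** N) -` V)"
  proof (intro set_eqI iffI)
    fix x assume "x \<in> {x \<in> SL. ?f x \<in> ?f ` (SL \<inter> V)}"
    then obtain g where x: "det x = 1" and g: "det g = 1" "g \<in> V" "?f x = ?f g" by (auto simp: SL_def)
    obtain x' where x': "x ** x' = mat 1" "x' ** x = mat 1"
      using x invertible_det_nz[of x] by (auto simp: invertible_def)
    have dx': "det x' = 1" using x det_mul[of x x'] by (simp add: x')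
    define N where "N = x' ** g"
    have "act N int_vecs = act x' (?f x)" by (simp add: N_def g(3) act_act)
    then have "act N int_vecs = int_vecs" by (simp add: act_act x')
    moreover have "det N = 1" by (simp add: N_def det_mul dx' g(1))
    ultimately have "unimod N" "det N = 1" by (auto simp: unimod_def invertible_det_nz)
    moreover have "x ** N = g" by (simp add: N_def matrix_mul_assoc x')
    ultimately show "x \<in> SL \<inter> (\<Union>N\<in>{N. unimod N \<and> det N = 1}. (\<lambda>x. x ** N) -` V)"
      using x g(2) by (auto simp: SL_def intro!: exI[of _ N])
  next
    fix x assume "x \<in> SL \<inter> (\<Union>N\<in>{N. unimod N \<and> det N = 1}. (\<lambda>x. x ** N) -` V)"
    then obtain N where "det x = 1" "unimod N" "det N = 1" "x ** N \<in> V" by (auto simp: SL_def)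
    then show "x \<in> {x \<in> SL. ?f x \<in> ?f ` (SL \<inter> V)}"
      by (auto simp: SL_def det_mul unimod_def simp flip: act_act intro!: image_eqI[of _ _ "x ** N"])
  qed
  moreover have "continuous_on UNIV (\<lambda>x. x ** N)" for N :: "real^'d^'d"
    by (intro linear_continuous_on linear_conv_bounded_linear[THEN iffD1] linearI)
       (auto simp: matrix_matrix_mult_def vec_eq_iff algebra_simps sum.distrib sum_distrib_left)
  then have "open (\<Union>N\<in>{N. unimod N \<and> det N = 1}. (\<lambda>x. x ** N) -` V)"
    using assms by (intro open_UN ballI open_vimage)
  ultimately show ?thesis
    unfolding lattice_top_def openin_quotient_top topspace_euclidean_subtopology
    by (auto intro: openin_open_Int)
qed

text \<open>One basis \<open>g'\<close> of the limit is fixed, and each \<open>G k\<close> is a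
  basis of the moved lattice in a shrinking ball around it. The flow carries \<open>g\<close> to
  another basis of the same lattice, so \<open>N k\<close> is the change between the two.\<close>

lemma accum_pts_lift:
  fixes g :: "real^('m::finite + 'n::finite)^('m + 'n)"
  assumes y: "y \<in> accum_pts (act g int_vecs)" and g: "invertible g"
  obtains g' t N G where "y = act g' int_vecs" "det g' = 1" "\<And>k::nat. 0 \<le> t k"
    "filterlim t at_top sequentially" "\<And>k. unimod (N k)"
    "\<And>k. G k ** N k = flow (t k) ** g" "\<And>k. det (G k) = 1" "G \<longlonglongrightarrow> g'"
proof -
  obtain \<tau> :: "nat \<Rightarrow> real" where \<tau>: "\<And>k. 0 \<le> \<tau> k" "\<not> bounded (range \<tau>)"
    "limitin lattice_top (\<lambda>k. act (flow (\<tau> k)) (act g int_vecs)) y sequentially"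
    and "y \<in> topspace lattice_top"
    using y unfolding accum_pts_def by blast
  then obtain g' where g': "det g' = 1" "y = act g' int_vecs"
    by (auto simp: lattice_top_def SL_def)
  have "\<exists>T G N. real k \<le> T \<and> det G = 1 \<and> dist G g' < 1 / real (Suc k) \<and> unimod N \<and> G ** N = flow T ** g" for k
  proof -
    let ?V = "(\<lambda>g. act g int_vecs) ` (SL \<inter> ball g' (1 / real (Suc k)))"
    have "y \<in> ?V" using g' by (auto simp: SL_def)
    then have "\<forall>\<^sub>F j in sequentially. act (flow (\<tau> j)) (act g int_vecs) \<in> ?V"
      using \<tau>(3) lattice_map_open[of "ball g' (1 / real (Suc k))"] unfolding limitin_def by blast
    then obtain J where J: "\<And>j. j \<ge> J \<Longrightarrow> act (flow (\<tau> j)) (act g int_vecs) \<in> ?V"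
      unfolding eventually_sequentially by blast
    \<comment> \<open>The times are only unbounded and need not tend to infinity. A finite initial
      segment contributes bounded values, so large times occur beyond every index.\<close>
    have "\<exists>j\<ge>J. real k \<le> \<tau> j"
    proof (rule ccontr)
      assume "\<not> ?thesis"
      then have "\<tau> j < real k" if "j \<ge> J" for j using that by (meson not_le)
      moreover have "\<tau> j \<le> Max (\<tau> ` {..J})" if "j \<le> J" for j using that by simp
      ultimately have "norm (\<tau> j) \<le> max (real k) (Max (\<tau> ` {..J}))" for j
        using \<tau>(1)[of j] by (cases "j \<le> J") (auto simp: le_max_iff_disj less_imp_le)
      then show False using \<tau>(2) by (auto simp: bounded_iff)
    qed
    then obtain j where j: "j \<ge> J" "real k \<le> \<tau> j" by blast
    obtain G where G: "det G = 1" "dist G g' < 1 / real (Suc k)" "act (flow (\<tau> j)) (act g int_vecs) = act G int_vecs"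
      using J[OF j(1)] by (auto simp: SL_def dist_commute)
    obtain G' where G': "G ** G' = mat 1" "G' ** G = mat 1"
      using G(1) invertible_det_nz[of G] by (auto simp: invertible_def)
    define N where "N = G' ** (flow (\<tau> j) ** g)"
    have "act N int_vecs = act G' (act (flow (\<tau> j)) (act g int_vecs))"
      by (simp add: N_def act_act matrix_mul_assoc)
    also have "\<dots> = int_vecs" by (simp add: G(3)) (simp add: act_act G')
    finally have "act N int_vecs = int_vecs" .
    moreover have "invertible (flow (\<tau> j) :: real^('m + 'n)^('m + 'n))" using flow_inverse by (auto simp: invertible_def)
    then have "invertible N" unfolding N_def using g G' by (intro invertible_mult) (auto simp: invertible_def)
    moreover have "G ** N = flow (\<tau> j) ** g" by (simp add: N_def matrix_mul_assoc G')
    ultimately show ?thesis using j(2) G unfolding unimod_def by blast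
  qed
  then obtain T G N where TGN: "\<And>k. real k \<le> T k \<and> det (G k) = 1 \<and> dist (G k) g' < 1 / real (Suc k) \<and> unimod (N k) \<and> G k ** N k = flow (T k) ** g"
    by metis
  have "filterlim T at_top sequentially"
    using TGN by (intro filterlim_at_top_mono[OF filterlim_real_sequentially]) auto
  moreover have "G \<longlonglongrightarrow> g'"
  proof (rule metric_tendsto_imp_tendsto[of "\<lambda>k. 1 / real (Suc k)" 0])
    show "(\<lambda>k. 1 / real (Suc k)) \<longlonglongrightarrow> 0" by (rule LIMSEQ_Suc[OF lim_1_over_n])
    show "\<forall>\<^sub>F k in sequentially. dist (G k) g' \<le> dist (1 / real (Suc k)) 0"
      using TGN by (auto simp: dist_real_def less_imp_le)
  qed
  moreover have "0 \<le> T k" for k using TGN[of k] by (meson of_nat_0_le_iff order_trans)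
  ultimately show ?thesis using TGN g' by (intro that[of g' T N G]) auto
qed

section \<open>Accumulation of bases together with characters\<close>

text \<open>The pair \<open>(g, \<kappa>)\<close> is approximated by bases of \<open>h\<^sub>T (G0 \<int>\<^sup>d)\<close>, \<open>T \<ge> S\<close>, where \<open>\<kappa>\<close> lives in the
  one-point compactification of the discrete set of values of the characters at \<open>e\<close>:
  \<open>Some c\<close> is a value that stays constant, \<open>None\<close> means escape from every finite set of values.\<close>

definition approx :: "real \<Rightarrow> real^('m + 'n)^('m + 'n) \<Rightarrow> real^('m + 'n) \<Rightarrow>
    real^('m::finite + 'n::finite)^('m + 'n) \<Rightarrow> (real^('m + 'n) \<Rightarrow> real option) \<Rightarrow> bool" where
  "approx S G0 e g \<kappa> \<longleftrightarrow> (\<forall>\<delta>>0. \<forall>F C. finite F \<longrightarrow> F \<subseteq> int_vecs \<longrightarrow> finite C \<longrightarrow>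
     (\<exists>T\<ge>S. \<exists>M G. unimod M \<and> G ** M = flow T ** G0 \<and> dist G g < \<delta> \<and>
        (\<forall>z\<in>F. \<forall>c\<in>C. z \<bullet> (M *v e) = c \<longleftrightarrow> \<kappa> z = Some c)))"

lemma approxD:
  assumes "approx S G0 e g \<kappa>" "0 < \<delta>" "finite F" "F \<subseteq> int_vecs" "finite C"
  obtains T M G where "S \<le> T" "unimod M" "G ** M = flow T ** G0" "dist G g < \<delta>"
    "\<forall>z\<in>F. \<forall>c\<in>C. z \<bullet> (M *v e) = c \<longleftrightarrow> \<kappa> z = Some c"
  using assms(1)[unfolded approx_def, THEN spec, THEN mp, OF assms(2), THEN spec, THEN spec,
      THEN mp, OF assms(3), THEN mp, OF assms(4), THEN mp, OF assms(5)] that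
  by (elim exE conjE) assumption

text \<open>Frequencies are additive in \<open>z\<close>, and a single approximant can test both
  vectors and their difference together.\<close>

lemma approx_diff:
  assumes "approx S G0 e g \<kappa>" "z \<in> int_vecs" "z' \<in> int_vecs" "\<kappa> z = Some c" "\<kappa> z' = Some c"
  shows "\<kappa> (z - z') = Some 0"
proof -
  obtain T M G where M: "\<forall>w\<in>{z, z', z - z'}. \<forall>a\<in>{c, 0}. w \<bullet> (M *v e) = a \<longleftrightarrow> \<kappa> w = Some a"
    by (rule approxD[OF assms(1), of 1 "{z, z', z - z'}" "{c, 0}"]) (use assms(2,3) int_vecs_diff in auto)
  then have "z \<bullet> (M *v e) = c" "z' \<bullet> (M *v e) = c" using assms(4,5) by blast+
  then have "(z - z') \<bullet> (M *v e) = 0" by (simp add: inner_diff_left)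
  then show ?thesis using M by blast
qed

text \<open>A diagonal argument: for each \<open>z\<close>, either some value recurs infinitely
  often and a subsequence keeps it, or every value occurs finitely often and the label is
  \<open>None\<close>.\<close>

lemma label_subsequence:
  fixes s :: "nat \<Rightarrow> 'a \<Rightarrow> 'b option"
  assumes "countable Z" "Z \<noteq> {}"
  obtains r \<kappa> where "strict_mono (r :: nat \<Rightarrow> nat)"
    "\<And>z c. z \<in> Z \<Longrightarrow> \<forall>\<^sub>F k in sequentially. s (r k) z = Some c \<longleftrightarrow> \<kappa> z = Some c"
proof -
  define P where "P n \<sigma> \<longleftrightarrow> (\<exists>l. \<forall>c. \<forall>\<^sub>F k in sequentially. s (\<sigma> k) (from_nat_into Z n) = Some c \<longleftrightarrow> l = Some c)"
    for n and \<sigma> :: "nat \<Rightarrow> nat"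
  have "\<exists>r'. strict_mono (r' :: nat \<Rightarrow> nat) \<and> P n (\<sigma> \<circ> r')" for n \<sigma>
  proof (cases "\<exists>c. infinite {k. s (\<sigma> k) (from_nat_into Z n) = Some c}")
    case True
    then obtain c where c: "infinite {k. s (\<sigma> k) (from_nat_into Z n) = Some c}" by blast
    then obtain r' :: "nat \<Rightarrow> nat" where r': "strict_mono r'" "\<forall>k. r' k \<in> {k. s (\<sigma> k) (from_nat_into Z n) = Some c}"
      using infinite_enumerate by blast
    then have "P n (\<sigma> \<circ> r')" unfolding P_def by (intro exI[of _ "Some c"]) simp
    with r'(1) show ?thesis by blast
  next
    case False
    have "\<forall>\<^sub>F k in sequentially. s (\<sigma> k) (from_nat_into Z n) = Some c \<longleftrightarrow> None = Some c" for c
    proof -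
      have "finite {k. s (\<sigma> k) (from_nat_into Z n) = Some c}" using False by blast
      then have "\<forall>\<^sub>F k in cofinite. s (\<sigma> k) (from_nat_into Z n) \<noteq> Some c"
        by (simp add: eventually_cofinite)
      then show ?thesis by (simp add: cofinite_eq_sequentially)
    qed
    then have "P n (\<sigma> \<circ> id)" unfolding P_def comp_id by blast
    moreover have "strict_mono (id :: nat \<Rightarrow> nat)" by (simp add: strict_mono_def)
    ultimately show ?thesis by blast
  qed
  then interpret subseqs P by unfold_locales
  define r where "r = diagseq"
  have stable: "P n (\<sigma> \<circ> r')" if r': "strict_mono r'" and P: "P n \<sigma>" for n \<sigma> and r' :: "nat \<Rightarrow> nat"
  proof -
    obtain l where "\<And>c. \<forall>\<^sub>F k in sequentially. s (\<sigma> k) (from_nat_into Z n) = Some c \<longleftrightarrow> l = Some c"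
      using P unfolding P_def by blast
    then have "\<forall>\<^sub>F k in sequentially. s (\<sigma> (r' k)) (from_nat_into Z n) = Some c \<longleftrightarrow> l = Some c" for c
      using filterlim_subseq[OF r'] by (rule eventually_compose_filterlim)
    then show ?thesis unfolding P_def comp_def by blast
  qed
  have "\<exists>l. \<forall>c. \<forall>\<^sub>F k in sequentially. s (r k) z = Some c \<longleftrightarrow> l = Some c" if z: "z \<in> Z" for z
  proof -
    obtain n where n: "from_nat_into Z n = z" using from_nat_into_surj[OF assms(1) z] by blast
    \<comment> \<open>The diagonal sequence is controlled by stage \<open>n\<close> only after a
      shift by \<open>Suc n\<close>, which is harmless for eventual statements.\<close>
    have "P n (diagseq \<circ> ((+) (Suc n)))" by (rule diagseq_holds) (rule stable)
    then obtain l where l: "\<And>c. \<forall>\<^sub>F k in sequentially. s (r (Suc n + k)) z = Some c \<longleftrightarrow> l = Some c"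
      unfolding P_def n r_def comp_def by blast
    have "\<forall>\<^sub>F k in sequentially. s (r k) z = Some c \<longleftrightarrow> l = Some c" for c
      using l[of c] eventually_sequentially_seg[of "\<lambda>k. s (r k) z = Some c \<longleftrightarrow> l = Some c" "Suc n"]
      by (simp add: add.commute)
    then show ?thesis by blast
  qed
  then obtain \<kappa> where "\<And>z. z \<in> Z \<Longrightarrow> \<forall>c. \<forall>\<^sub>F k in sequentially. s (r k) z = Some c \<longleftrightarrow> \<kappa> z = Some c"
    by metis
  then show ?thesis using that[of r \<kappa>] subseq_diagseq r_def by blast
qed

lemma countable_int_vecs: "countable (int_vecs :: (real^'k) set)"
proof -
  have "int_vecs \<subseteq> range (\<lambda>f :: 'k \<Rightarrow> int. (\<chi> i. of_int (f i)) :: real^'k)"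
  proof
    fix v :: "real^'k" assume "v \<in> int_vecs"
    then have "v = (\<chi> i. of_int \<lfloor>v $ i\<rfloor>)" by (simp add: int_vecs_def vec_eq_iff)
    then show "v \<in> range (\<lambda>f :: 'k \<Rightarrow> int. (\<chi> i. of_int (f i)) :: real^'k)" by (intro image_eqI) auto
  qed
  then show ?thesis by (rule countable_subset) simp
qed

lemma zero_int_vecs [simp]: "0 \<in> int_vecs"
  by (simp add: int_vecs_def)

lemma bounded_linear_matrix_mult_right: "bounded_linear (\<lambda>X :: real^'b^'a. X ** (B :: real^'c^'b))"
  and bounded_linear_matrix_mult_left: "bounded_linear (\<lambda>X :: real^'c^'b. (A :: real^'b^'a) ** X)"
  by (rule linear_conv_bounded_linear[THEN iffD1], rule linearI,
      auto simp: matrix_matrix_mult_def vec_eq_iff algebra_simps sum.distrib sum_distrib_left)+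

lemma inner_matrix_mult: "z \<bullet> (A *v x) = (transpose A *v z) \<bullet> x" for A :: "real^'b^'a"
  by (simp add: dot_lmul_matrix transpose_matrix_vector)

text \<open>The index \<open>k\<close> is fixed first; only then is \<open>X\<close> taken so close
  to \<open>g\<close> that the continuous map \<open>?f\<close>, which depends on \<open>k\<close>,
  sends it near \<open>G k\<close>. Flow times add, basis changes multiply, and the frequency of
  \<open>z\<close> is read at \<open>transpose (N k) *v z\<close>. The bound \<open>S\<close> is met
  by \<open>t k\<close> alone.\<close>

lemma approx_step:
  fixes g g' :: "real^('m::finite + 'n::finite)^('m + 'n)"
  assumes ap: "approx 0 G0 e g \<kappa>" and t: "filterlim t at_top sequentially"
    and N: "\<And>k. unimod (N k)" and G: "\<And>k. G k ** N k = flow (t k) ** g" "G \<longlonglongrightarrow> g'"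
    and conv: "\<And>z c. z \<in> int_vecs \<Longrightarrow> \<forall>\<^sub>F k in sequentially. \<kappa> (transpose (N k) *v z) = Some c \<longleftrightarrow> \<kappa>' z = Some c"
  shows "approx S G0 e g' \<kappa>'"
  unfolding approx_def
proof (intro allI impI)
  fix \<delta> :: real and F :: "(real^('m + 'n)) set" and C :: "real set"
  assume \<delta>: "0 < \<delta>" and F: "finite F" "F \<subseteq> int_vecs" and C: "finite C"
  have "\<forall>\<^sub>F k in sequentially. \<forall>z\<in>F. \<forall>c\<in>C. \<kappa> (transpose (N k) *v z) = Some c \<longleftrightarrow> \<kappa>' z = Some c"
    using F C conv by (intro eventually_ball_finite ballI) auto
  moreover have "\<forall>\<^sub>F k in sequentially. dist (G k) g' < \<delta> / 2"
    using tendstoD[OF G(2), of "\<delta> / 2"] \<delta> by simp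
  moreover have "\<forall>\<^sub>F k in sequentially. max S 0 \<le> t k"
    using t unfolding filterlim_at_top by blast
  ultimately have "\<forall>\<^sub>F k in sequentially. (\<forall>z\<in>F. \<forall>c\<in>C. \<kappa> (transpose (N k) *v z) = Some c \<longleftrightarrow> \<kappa>' z = Some c)
      \<and> dist (G k) g' < \<delta> / 2 \<and> max S 0 \<le> t k"
    by eventually_elim blast
  then obtain k where k: "\<forall>z\<in>F. \<forall>c\<in>C. \<kappa> (transpose (N k) *v z) = Some c \<longleftrightarrow> \<kappa>' z = Some c"
      "dist (G k) g' < \<delta> / 2" "max S 0 \<le> t k"
    using eventually_happens'[OF sequentially_bot] by blast
  obtain N' where N': "N k ** N' = mat 1" "N' ** N k = mat 1"
    using unimod_inverse[OF N] by metis
  let ?f = "\<lambda>X. flow (t k) ** X ** N'"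
  have "bounded_linear ?f"
    by (rule bounded_linear_compose[OF bounded_linear_matrix_mult_right bounded_linear_matrix_mult_left])
  then have "isCont ?f g" by (rule linear_continuous_at)
  then obtain \<eta> where \<eta>: "\<eta> > 0" "\<And>X. dist X g < \<eta> \<Longrightarrow> dist (?f X) (?f g) < \<delta> / 2"
    using \<delta> unfolding continuous_at_eps_delta by (metis half_gt_zero)
  have fg: "?f g = G k"
    by (metis G(1) N'(1) matrix_mul_assoc matrix_mul_rid)
  obtain T M X where M: "0 \<le> T" "unimod M" "X ** M = flow T ** G0" "dist X g < \<eta>"
    "\<forall>z\<in>(\<lambda>z. transpose (N k) *v z) ` F. \<forall>c\<in>C. z \<bullet> (M *v e) = c \<longleftrightarrow> \<kappa> z = Some c"
    by (rule approxD[OF ap \<eta>(1), of "(\<lambda>z. transpose (N k) *v z) ` F" C])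
       (use F C unimod_int[OF unimod_transpose[OF N]] in auto)
  show "\<exists>T\<ge>S. \<exists>M G. unimod M \<and> G ** M = flow T ** G0 \<and> dist G g' < \<delta> \<and>
        (\<forall>z\<in>F. \<forall>c\<in>C. z \<bullet> (M *v e) = c \<longleftrightarrow> \<kappa>' z = Some c)"
  proof (intro exI conjI ballI)
    show "S \<le> t k + T" using k(3) M(1) by simp
    show "unimod (N k ** M)" by (intro unimod_mult N M(2))
    have "?f X ** (N k ** M) = flow (t k) ** X ** (N' ** N k) ** M" by (simp add: matrix_mul_assoc)
    also have "\<dots> = flow (t k) ** (X ** M)" by (simp add: N' matrix_mul_assoc)
    also have "\<dots> = flow (t k + T) ** G0" by (simp add: M(3) matrix_mul_assoc flow_add)
    finally show "?f X ** (N k ** M) = flow (t k + T) ** G0" .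
    show "dist (?f X) g' < \<delta>"
      using \<eta>(2)[OF M(4)] k(2) dist_triangle[of "?f X" g' "G k"] unfolding fg by simp
    fix z c assume zc: "z \<in> F" "c \<in> C"
    have "z \<bullet> ((N k ** M) *v e) = (transpose (N k) *v z) \<bullet> (M *v e)"
      by (metis inner_matrix_mult matrix_vector_mul_assoc)
    then show "z \<bullet> ((N k ** M) *v e) = c \<longleftrightarrow> \<kappa>' z = Some c"
      using M(5) k(1) zc by auto
  qed
qed

lemma tendsto_matrix_vector_mult:
  fixes A :: "'x \<Rightarrow> real^'b^'a"
  assumes "(A \<longlongrightarrow> L) F" "(v \<longlongrightarrow> w) F"
  shows "((\<lambda>x. A x *v v x) \<longlongrightarrow> L *v w) F"
  unfolding matrix_vector_mult_def
  by (intro tendsto_vec_lambda tendsto_sum tendsto_mult tendsto_vec_nth assms)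

lemma tendsto_transpose:
  fixes A :: "'x \<Rightarrow> real^'b^'a"
  assumes "(A \<longlongrightarrow> L) F"
  shows "((\<lambda>x. transpose (A x)) \<longlongrightarrow> transpose L) F"
  unfolding transpose_def by (intro tendsto_vec_lambda tendsto_vec_nth assms)

lemma norm_int_vec_ge_1:
  assumes "v \<in> int_vecs" "v \<noteq> 0" shows "1 \<le> norm v"
proof -
  obtain i where "v $ i \<noteq> 0" using assms(2) by (auto simp: vec_eq_iff)
  then have "1 \<le> \<bar>v $ i\<bar>" using assms(1) by (intro Ints_nonzero_abs_ge1) (auto simp: int_vecs_def)
  then show ?thesis using component_le_norm_cart[of v i] by linarith
qed

text \<open>The dual flow would shrink a dual vector without second component to zero, which is
  impossible along a convergent sequence of lattices.\<close>

lemma dual_vsnd_nonzero: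
  fixes g g' :: "real^('m::finite + 'n::finite)^('m + 'n)"
  assumes t: "filterlim t at_top sequentially"
    and N: "\<And>k. unimod (N k)" and G: "\<And>k. G k ** N k = flow (t k) ** g" "G \<longlonglongrightarrow> g'"
    and h: "transpose g ** h = mat 1" and y: "y \<in> int_vecs" "y \<noteq> 0"
  shows "vsnd (h *v y) \<noteq> 0"
proof
  assume z: "vsnd (h *v y) = 0"
  have "\<exists>z\<in>int_vecs. transpose (N k) *v z = y" for k
  proof -
    have "y \<in> (\<lambda>v. transpose (N k) *v v) ` int_vecs"
      using unimod_transpose[OF N[of k]] y(1) unfolding unimod_def act_def by simp
    then show ?thesis by auto
  qed
  then obtain z where z: "\<And>k. z k \<in> int_vecs" "\<And>k. transpose (N k) *v z k = y" by metis
  have "((\<lambda>t. exp (real CARD('n) * (- t))) \<longlongrightarrow> 0) at_top"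
    by (intro filterlim_compose[OF exp_at_bot] filterlim_tendsto_pos_mult_at_bot[OF tendsto_const] filterlim_uminus_at_bot_at_top) simp
  then have "(\<lambda>k. exp (real CARD('n) * (- t k))) \<longlonglongrightarrow> 0" using t by (rule filterlim_compose)
  then have "(\<lambda>k. vpair (exp (real CARD('n) * (- t k)) *\<^sub>R vfst (h *v y)) 0) \<longlonglongrightarrow> vpair (0 *\<^sub>R vfst (h *v y)) (0::real^'n)"
    by (intro tendsto_vpair tendsto_intros)
  moreover have "vpair (0 *\<^sub>R vfst (h *v y)) 0 = (0 :: real^('m + 'n))" by (simp add: vec_sum_eq_iff)
  ultimately have "(\<lambda>k. flow (- t k) *v (h *v y)) \<longlonglongrightarrow> 0"
    using \<open>vsnd (h *v y) = 0\<close> by (simp add: flow_mult)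
  then have "(\<lambda>k. transpose (G k) *v (flow (- t k) *v (h *v y))) \<longlonglongrightarrow> transpose g' *v 0"
    by (intro tendsto_matrix_vector_mult tendsto_transpose G(2))
  moreover have "transpose (G k) *v (flow (- t k) *v (h *v y)) = z k" for k
    using dual_coordinates[OF G(1) h, of k "z k"] by (simp only: z(2))
  ultimately have "z \<longlonglongrightarrow> 0" by simp
  then have "\<forall>\<^sub>F k in sequentially. dist (z k) 0 < 1" by (rule tendstoD) simp
  then obtain k where "norm (z k) < 1" 
    using eventually_happens'[OF sequentially_bot] by fastforce
  moreover have "z k \<noteq> 0" using z(2)[of k] y(2) by auto
  ultimately show False using norm_int_vec_ge_1[OF z(1)[of k]] by simp
qed

text \<open>When the constant characters form a group of rank at most one, no nonzero dual vector of the
  limit lattice keeps a constant character: the second components of its predecessors tend to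
  zero and the predecessors differ by elements of a discrete line with nonzero second component,
  so they are eventually constant and the dual flow shrinks them to zero.\<close>

lemma last_step_label_None:
  fixes g g' :: "real^('m::finite + 'n::finite)^('m + 'n)"
  assumes ap: "approx 0 G0 e g \<kappa>" and g: "invertible g" and t: "filterlim t at_top sequentially"
    and N: "\<And>k. unimod (N k)" and G: "\<And>k. G k ** N k = flow (t k) ** g" "\<And>k. det (G k) = 1"
      "G \<longlonglongrightarrow> g'" "det g' = 1"
    and conv: "\<And>z c. z \<in> int_vecs \<Longrightarrow> \<forall>\<^sub>F k in sequentially. \<kappa> (transpose (N k) *v z) = Some c \<longleftrightarrow> \<kappa>' z = Some c"
    and dim: "dim {z \<in> int_vecs. \<kappa> z = Some 0} \<le> 1" and z: "z \<in> int_vecs" "z \<noteq> 0"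
  shows "\<kappa>' z = None"
proof (rule ccontr)
  assume "\<kappa>' z \<noteq> None"
  then obtain c where "\<kappa>' z = Some c" by blast
  then have "\<forall>\<^sub>F k in sequentially. \<kappa> (transpose (N k) *v z) = Some c"
    using conv[OF z(1), of c] by simp
  then obtain K where K: "\<And>k. k \<ge> K \<Longrightarrow> \<kappa> (transpose (N k) *v z) = Some c"
    unfolding eventually_sequentially by blast
  let ?Y = "{z \<in> int_vecs. \<kappa> z = Some 0}"
  define p where "p k = transpose (N k) *v z" for k
  have pint: "p k \<in> int_vecs" for k
    unfolding p_def by (rule unimod_int[OF unimod_transpose[OF N] z(1)])
  have pdiff: "p k - p l \<in> ?Y" if "k \<ge> K" "l \<ge> K" for k l
    using approx_diff[OF ap pint pint, of k c l] K that int_vecs_diff[OF pint pint] by (simp add: p_def)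
  have "invertible (transpose g)" "invertible (transpose g')"
    using g G(4) by (auto simp: transpose_invertible invertible_det_nz)
  then obtain h h' where h: "transpose g ** h = mat 1" and h': "transpose g' ** h' = mat 1"
    by (auto simp: invertible_def)
  have lim: "(\<lambda>k. flow (- t k) *v (h *v p k)) \<longlonglongrightarrow> h' *v z"
  proof (rule tendsto_transpose_solution[OF G(3) G(2) G(4)])
    show "transpose (G k) *v (flow (- t k) *v (h *v p k)) = z" for k
      unfolding p_def by (rule dual_coordinates[OF G(1) h(1)])
    show "transpose g' *v (h' *v z) = z" by (metis h' matrix_vector_mul_assoc matrix_vector_mul_lid)
  qed
  have L0: "h' *v z \<noteq> 0"
    by (metis h' z(2) matrix_vector_mul_assoc matrix_vector_mul_lid matrix_vector_mult_0_right)
  have exp0: "(\<lambda>k. exp (- (c * t k))) \<longlonglongrightarrow> 0" if "c > 0" for c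
    using that t by (intro filterlim_compose[OF exp_at_bot] filterlim_compose[OF filterlim_uminus_at_bot_at_top] filterlim_tendsto_pos_mult_at_top[OF tendsto_const])
  \<comment> \<open>The dual flow expands second components by \<open>exp (m t)\<close>, so
    convergence of the images forces those of the predecessors to vanish in the limit.\<close>
  have "(\<lambda>k. exp (- (real CARD('m) * t k)) *\<^sub>R vsnd (flow (- t k) *v (h *v p k))) \<longlonglongrightarrow> 0 *\<^sub>R vsnd (h' *v z)"
    by (intro tendsto_intros exp0 tendsto_vsnd lim) simp
  then have vs: "(\<lambda>k. vsnd (h *v p k)) \<longlonglongrightarrow> 0"
    by (simp add: flow_mult exp_add[symmetric])
  have "\<exists>K'\<ge>K. \<forall>k\<ge>K'. p k = p K'"
  proof (cases "?Y \<subseteq> {0}")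
    case True
    then have "p k = p K" if "k \<ge> K" for k using pdiff[OF that, of K] by auto
    then show ?thesis by blast
  next
    case False
    then obtain y where y: "y \<in> ?Y" "y \<noteq> 0" by blast
    then obtain i where i: "y $ i \<noteq> 0" by (auto simp: vec_eq_iff)
    have "?Y \<subseteq> span {y}" using y dim by (intro card_ge_dim_independent) auto
    let ?w = "vsnd (h *v y)"
    have w: "?w \<noteq> 0" using dual_vsnd_nonzero[OF t N G(1) G(3) h(1)] y by blast
    \<comment> \<open>Two second components shorter than \<epsilon> differ by less than
      \<open>norm ?w / \<bar>y $ i\<bar>\<close>; for predecessors differing by
      \<open>\<alpha> *\<^sub>R y\<close> this makes the integer \<open>\<alpha> * y $ i\<close>
      smaller than one in absolute value.\<close>
    define \<epsilon> where "\<epsilon> = norm ?w / \<bar>y $ i\<bar> / 2"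
    have "\<epsilon> > 0" using w i by (simp add: \<epsilon>_def)
    then have "\<forall>\<^sub>F k in sequentially. norm (vsnd (h *v p k)) < \<epsilon>"
      using tendstoD[OF vs] by (simp add: dist_norm)
    then obtain K1 where K1: "\<And>k. k \<ge> K1 \<Longrightarrow> norm (vsnd (h *v p k)) < \<epsilon>"
      unfolding eventually_sequentially by blast
    define K' where "K' = max K K1"
    have "p k = p K'" if k: "k \<ge> K'" for k
    proof -
      have m: "p k - p K' \<in> ?Y" using k by (intro pdiff) (auto simp: K'_def)
      then have "p k - p K' \<in> span {y}" using \<open>?Y \<subseteq> span {y}\<close> by blast
      then obtain \<alpha> where \<alpha>: "p k - p K' = \<alpha> *\<^sub>R y" by (auto simp: span_singleton)
      have "\<alpha> *\<^sub>R ?w = vsnd (h *v p k) - vsnd (h *v p K')"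
        using arg_cong[OF \<alpha>, of "\<lambda>v. vsnd (h *v v)"]
        by (simp add: matrix_vector_mult_diff_distrib matrix_vector_mult_scaleR)
      then have "\<bar>\<alpha>\<bar> * norm ?w \<le> norm (vsnd (h *v p k)) + norm (vsnd (h *v p K'))"
        by (metis norm_scaleR norm_triangle_ineq4)
      also have "\<dots> < \<epsilon> + \<epsilon>" using k by (intro add_strict_mono K1) (auto simp: K'_def)
      also have "\<dots> = norm ?w / \<bar>y $ i\<bar>" by (simp add: \<epsilon>_def)
      finally have "\<bar>\<alpha> * y $ i\<bar> < 1" using w i by (simp add: field_simps abs_mult)
      moreover have "\<alpha> * y $ i \<in> \<int>"
        using m unfolding \<alpha> by (auto simp: int_vecs_def)
      ultimately have "\<alpha> * y $ i = 0" using Ints_nonzero_abs_ge1 by force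
      then show ?thesis using \<alpha> i by simp
    qed
    moreover have "K \<le> K'" by (simp add: K'_def)
    ultimately show ?thesis by blast
  qed
  then obtain K' where K': "\<And>k. k \<ge> K' \<Longrightarrow> p k = p K'" by blast
  have ev: "\<forall>\<^sub>F k in sequentially. p k = p K'" using K' unfolding eventually_sequentially by blast
  let ?v = "h *v p K'"
  have "(\<lambda>k. vsnd (h *v p k)) \<longlonglongrightarrow> vsnd ?v"
    by (rule tendsto_eventually) (use ev in eventually_elim, simp)
  then have v0: "vsnd ?v = 0" using vs LIMSEQ_unique by blast
  have "(\<lambda>k. vpair (exp (- (real CARD('n) * t k)) *\<^sub>R vfst ?v) 0) \<longlonglongrightarrow> vpair (0 *\<^sub>R vfst ?v) (0::real^'n)"
    by (intro tendsto_vpair tendsto_intros exp0) simp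
  moreover have "vpair (0 *\<^sub>R vfst ?v) 0 = (0 :: real^('m + 'n))" by (simp add: vec_sum_eq_iff)
  ultimately have "(\<lambda>k. flow (- t k) *v ?v) \<longlonglongrightarrow> 0" by (simp add: flow_mult v0)
  then have "(\<lambda>k. flow (- t k) *v (h *v p k)) \<longlonglongrightarrow> 0"
    by (rule Lim_transform_eventually) (use ev in eventually_elim, simp)
  then show False using lim L0 LIMSEQ_unique by blast
qed

text \<open>The \<open>approx\<close> relation transports the labels of each new limit back to the
  orbit of \<open>G0\<close>. Once all nonzero vectors are labelled \<open>None\<close>, testing
  them against a finite \<open>C\<close> says exactly that their frequencies avoid
  \<open>C\<close>.\<close>

theorem mixing_limit:
  fixes G0 :: "real^('m::finite + 'n::finite)^('m + 'n)"
  assumes cop: "coprime CARD('m) CARD('n)" and xs: "accum_seq (act G0 int_vecs) xs"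
      "length xs = CARD('m) + CARD('n)"
    and G0: "invertible G0" and e: "e \<noteq> 0"
  obtains g where "det g = 1"
    "\<forall>S \<delta> F C. 0 < \<delta> \<longrightarrow> finite F \<longrightarrow> F \<subseteq> int_vecs - {0} \<longrightarrow> finite C \<longrightarrow>
      (\<exists>T\<ge>S. \<exists>M G. unimod M \<and> G ** M = flow T ** G0 \<and> dist G g < \<delta> \<and>
        (\<forall>z\<in>F. z \<bullet> (M *v e) \<notin> C))"
proof -
  let ?d = "CARD('m) + CARD('n)"
  let ?Y = "\<lambda>\<kappa> :: _ \<Rightarrow> real option. {z :: real^('m + 'n). z \<in> int_vecs \<and> \<kappa> z = Some 0}"
  have d2: "2 \<le> ?d" using zero_less_card_finite[where 'a='m] zero_less_card_finite[where 'a='n] by linarith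
  have step: "\<exists>g' t N G \<kappa>'. xs ! Suc j = act g' int_vecs \<and> det g' = 1 \<and> filterlim t at_top sequentially \<and>
      (\<forall>k. unimod (N k)) \<and> (\<forall>k. G k ** N k = flow (t k) ** g) \<and> (\<forall>k. det (G k) = 1) \<and> G \<longlonglongrightarrow> g' \<and>
      (\<forall>z\<in>int_vecs. \<forall>c. \<forall>\<^sub>F k in sequentially. \<kappa> (transpose (N k) *v z) = Some c \<longleftrightarrow> \<kappa>' z = Some c)"
    if j: "Suc j < ?d" "xs ! j = act g int_vecs" "invertible g"
    for j and g :: "real^('m + 'n)^('m + 'n)" and \<kappa> :: "real^('m + 'n) \<Rightarrow> real option"
  proof -
    have "xs ! Suc j \<in> accum_pts (xs ! j)" using xs j(1) unfolding accum_seq_def by simp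
    then have "xs ! Suc j \<in> accum_pts (act g int_vecs)" by (simp only: j(2))
    then obtain g' t N G where L: "xs ! Suc j = act g' int_vecs" "det g' = 1" "\<And>k::nat. 0 \<le> t k"
      "filterlim t at_top sequentially" "\<And>k. unimod (N k)"
      "\<And>k. G k ** N k = flow (t k) ** g" "\<And>k. det (G k) = 1" "G \<longlonglongrightarrow> g'"
      by (rule accum_pts_lift[OF _ j(3)]) blast
    obtain r \<kappa>' where r: "strict_mono r"
      and \<kappa>': "\<And>z c. z \<in> int_vecs \<Longrightarrow> \<forall>\<^sub>F k in sequentially. \<kappa> (transpose (N (r k)) *v z) = Some c \<longleftrightarrow> \<kappa>' z = Some c"
      by (rule label_subsequence[OF countable_int_vecs, of "\<lambda>k z. \<kappa> (transpose (N k) *v z)"])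
         (use zero_int_vecs in blast)+
    have "filterlim (\<lambda>k. t (r k)) at_top sequentially"
      using L(4) filterlim_subseq[OF r] by (rule filterlim_compose)
    moreover have "(\<lambda>k. G (r k)) \<longlonglongrightarrow> g'"
      using L(8) filterlim_subseq[OF r] by (rule filterlim_compose)
    ultimately show ?thesis
      using L(1,2,5,6,7) \<kappa>'
      by (intro exI[of _ g'] exI[of _ "\<lambda>k. t (r k)"] exI[of _ "\<lambda>k. N (r k)"] exI[of _ "\<lambda>k. G (r k)"] exI[of _ \<kappa>']) simp
  qed
  have "\<exists>g \<kappa>. xs ! j = act g int_vecs \<and> invertible g \<and> approx 0 G0 e g \<kappa> \<and> dim (?Y \<kappa>) \<le> ?d - 1 - j"
    if "j \<le> ?d - 2" for j
    using that
  proof (induction j)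
    case 0
    \<comment> \<open>At the start \<open>G0\<close> approximates itself at time zero, and the
      labels are the actual frequencies.\<close>
    define \<kappa> where "\<kappa> z = Some (z \<bullet> e)" for z
    have "approx 0 G0 e G0 \<kappa>"
      unfolding approx_def \<kappa>_def
      by (intro allI impI exI[of _ 0] conjI order_refl exI[of _ "mat 1"] exI[of _ G0])
         (simp_all add: unimod_mat_1 flow_0)
    moreover have "dim (?Y \<kappa>) \<le> dim {z. e \<bullet> z = 0}"
      by (rule dim_subset) (auto simp: \<kappa>_def inner_commute)
    moreover have "dim {z. e \<bullet> z = 0} = ?d - 1" using dim_hyperplane[OF e] by simp
    moreover have "xs ! 0 = act G0 int_vecs" using xs unfolding accum_seq_def by blast
    ultimately show ?case using G0 by (intro exI[of _ G0] exI[of _ \<kappa>]) simp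
  next
    case (Suc j)
    then obtain g \<kappa> where IH: "xs ! j = act g int_vecs" "invertible g" "approx 0 G0 e g \<kappa>" "dim (?Y \<kappa>) \<le> ?d - 1 - j"
      by auto
    have "Suc j < ?d" using Suc(2) d2 by simp
    from step[OF this IH(1,2), of \<kappa>] obtain g' t N G \<kappa>' where
      L: "xs ! Suc j = act g' int_vecs" "det g' = 1" "filterlim t at_top sequentially"
      "\<And>k. unimod (N k)" "\<And>k. G k ** N k = flow (t k) ** g" "\<And>k. det (G k) = 1" "G \<longlonglongrightarrow> g'"
      "\<And>z c. z \<in> int_vecs \<Longrightarrow> \<forall>\<^sub>F k in sequentially. \<kappa> (transpose (N k) *v z) = Some c \<longleftrightarrow> \<kappa>' z = Some c"
      by blast
    have ap: "approx 0 G0 e g' \<kappa>'" by (rule approx_step[OF IH(3) L(3,4,5,7,8)])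
    have "\<forall>\<^sub>F k in sequentially. transpose (N k) *v z \<in> ?Y \<kappa>" if z: "z \<in> ?Y \<kappa>'" for z
    proof -
      have "\<forall>\<^sub>F k in sequentially. \<kappa> (transpose (N k) *v z) = Some 0"
        using L(8)[of z 0] z by simp
      then show ?thesis
        by eventually_elim (use z unimod_int[OF unimod_transpose[OF L(4)]] in simp)
    qed
    moreover have "dim (?Y \<kappa>) < ?d" using IH(4) d2 by linarith
    ultimately have "dim (?Y \<kappa>') < dim (?Y \<kappa>) \<or> dim (?Y \<kappa>') = 0"
      by (intro rank_drop[OF cop IH(2) L(3,4,5,6,7,2)]) auto
    then have "dim (?Y \<kappa>') \<le> ?d - 1 - Suc j" using IH(4) by linarith
    moreover have "invertible g'" using L(2) by (simp add: invertible_det_nz)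
    ultimately show ?case using L(1) ap by blast
  qed
  from this[of "?d - 2"] obtain g \<kappa> where A: "xs ! (?d - 2) = act g int_vecs" "invertible g" "approx 0 G0 e g \<kappa>"
    "dim (?Y \<kappa>) \<le> ?d - 1 - (?d - 2)" by auto
  \<comment> \<open>A list of length \<open>?d\<close> ends at index \<open>?d - 1\<close>, so
    exactly one step is left.\<close>
  have "Suc (?d - 2) < ?d" using d2 by simp
  from step[OF this A(1,2), of \<kappa>] obtain g' t N G \<kappa>' where
      L: "det g' = 1" "filterlim t at_top sequentially"
      "\<And>k. unimod (N k)" "\<And>k. G k ** N k = flow (t k) ** g" "\<And>k. det (G k) = 1" "G \<longlonglongrightarrow> g'"
      "\<And>z c. z \<in> int_vecs \<Longrightarrow> \<forall>\<^sub>F k in sequentially. \<kappa> (transpose (N k) *v z) = Some c \<longleftrightarrow> \<kappa>' z = Some c"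
    by blast
  have "dim (?Y \<kappa>) \<le> 1" using A(4) d2 by linarith
  then have none: "\<kappa>' z = None" if "z \<in> int_vecs - {0}" for z
    using that by (intro last_step_label_None[OF A(3,2) L(2,3,4,5,6,1,7)]) auto
  have "\<exists>T\<ge>S. \<exists>M G. unimod M \<and> G ** M = flow T ** G0 \<and> dist G g' < \<delta> \<and> (\<forall>z\<in>F. z \<bullet> (M *v e) \<notin> C)"
    if h: "0 < \<delta>" "finite F" "F \<subseteq> int_vecs - {0}" "finite C" for S \<delta> F C
  proof -
    have F: "F \<subseteq> int_vecs" using h(3) by blast
    obtain T M G where TMG: "S \<le> T" "unimod M" "G ** M = flow T ** G0" "dist G g' < \<delta>"
      "\<forall>z\<in>F. \<forall>c\<in>C. z \<bullet> (M *v e) = c \<longleftrightarrow> \<kappa>' z = Some c"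
      using approxD[OF approx_step[OF A(3) L(2,3,4,6,7)] h(1,2) F h(4)] .
    moreover have "\<forall>z\<in>F. z \<bullet> (M *v e) \<notin> C" using TMG(5) none h(3) by fastforce
    ultimately show ?thesis by blast
  qed
  then show ?thesis using that[OF L(1)] by simp
qed

section \<open>Characters on the torus\<close>

lemma openin_torus_top: "openin torus_top V \<longleftrightarrow> V \<subseteq> range torus_proj \<and> open {y. torus_proj y \<in> V}"
  by (simp add: torus_top_def openin_quotient_top)

lemma topspace_torus_top: "topspace torus_top = range torus_proj"
  by (simp add: torus_top_def)

lemma space_torus_borel: "space torus_borel = range torus_proj"
  unfolding torus_borel_def by (subst space_measure_of) (auto simp: topspace_torus_top openin_torus_top)

lemma openin_sets_torus_borel: "openin torus_top V \<Longrightarrow> V \<in> sets torus_borel"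
  unfolding torus_borel_def
  by (subst sets_measure_of) (auto simp: topspace_torus_top openin_torus_top)

lemma torus_proj_self: "y \<in> torus_proj y"
  unfolding torus_proj_def by (rule image_eqI[of _ _ 0]) (simp_all add: zero_int_vecs)

lemma borel_measurable_torusI:
  fixes f :: "_ \<Rightarrow> 'b::topological_space"
  assumes "continuous_on UNIV (\<lambda>y. f (torus_proj y))"
  shows "f \<in> borel_measurable torus_borel"
proof (rule borel_measurableI)
  fix S :: "'b set" assume "open S"
  have "open ((\<lambda>y. f (torus_proj y)) -` S)" using open_vimage[OF \<open>open S\<close> assms] .
  moreover have "{y. torus_proj y \<in> f -` S \<inter> range torus_proj} = (\<lambda>y. f (torus_proj y)) -` S" by auto
  ultimately have "openin torus_top (f -` S \<inter> range torus_proj)"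
    by (simp add: openin_torus_top)
  then show "f -` S \<inter> space torus_borel \<in> sets torus_borel"
    by (simp add: space_torus_borel openin_sets_torus_borel)
qed

text \<open>Independent of the chosen representative only for integral \<open>a\<close>.\<close>

definition chi :: "real^'m \<Rightarrow> (real^'m) set \<Rightarrow> complex" where
  "chi a c = cis (2 * pi * (a \<bullet> (SOME y. y \<in> c)))"

lemma cis_2pi_add_Ints: "k \<in> \<int> \<Longrightarrow> cis (2 * pi * (x + k)) = cis (2 * pi * x)"
  by (simp add: distrib_left cis_multiple_2pi flip: cis_mult)

lemma inner_int_vecs: "a \<in> int_vecs \<Longrightarrow> b \<in> int_vecs \<Longrightarrow> a \<bullet> b \<in> \<int>"
  by (auto simp: inner_vec_def int_vecs_def intro!: Ints_sum Ints_mult)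

lemma chi_proj:
  assumes "a \<in> int_vecs"
  shows "chi a (torus_proj y) = cis (2 * pi * (a \<bullet> y))"
proof -
  have "(SOME x. x \<in> torus_proj y) \<in> torus_proj y" using torus_proj_self by (rule someI)
  then obtain p where p: "p \<in> int_vecs" "(SOME x. x \<in> torus_proj y) = y + p"
    unfolding torus_proj_def by auto
  then show ?thesis
    using assms by (simp add: chi_def inner_add_right cis_2pi_add_Ints inner_int_vecs)
qed

lemma norm_chi [simp]: "norm (chi a c) = 1"
  by (simp add: chi_def)

lemma chi_0 [simp]: "chi 0 c = 1"
  by (simp add: chi_def)

lemma chi_mult_cnj: "chi a c * cnj (chi b c) = chi (a - b) c"
  by (simp add: chi_def cis_cnj cis_mult inner_diff_left algebra_simps)

lemma chi_measurable: "a \<in> int_vecs \<Longrightarrow> chi a \<in> borel_measurable torus_borel"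
  by (rule borel_measurable_torusI) (auto simp: chi_proj intro!: continuous_intros)

section \<open>Fourier coefficients for a measure invariant along a line\<close>

locale line_invariant = prob_space \<mu> for \<mu> :: "(real^'m) set measure" +
  fixes u :: "real^'m"
  assumes sets_eq: "sets \<mu> = sets torus_borel"
    and invariant: "\<And>s E. E \<in> sets \<mu> \<Longrightarrow> emeasure \<mu> (torus_translate (s *\<^sub>R u) ` E) = emeasure \<mu> E"
begin

lemma space_eq: "space \<mu> = range torus_proj"
  using sets_eq_imp_space_eq[OF sets_eq] by (simp add: space_torus_borel)

lemma chi_borel [measurable]: "a \<in> int_vecs \<Longrightarrow> chi a \<in> borel_measurable \<mu>"
  using chi_measurable measurable_cong_sets[OF sets_eq refl] by blast

lemma translate_measurable: "torus_translate v \<in> measurable \<mu> \<mu>"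
proof -
  have "torus_translate v \<in> measurable \<mu> torus_borel"
    unfolding torus_borel_def
  proof (rule measurable_measure_of)
    show "{V. openin torus_top V} \<subseteq> Pow (topspace torus_top)" by (auto dest: openin_subset)
    show "torus_translate v \<in> space \<mu> \<rightarrow> topspace torus_top"
      by (auto simp: space_eq topspace_torus_top torus_translate_proj)
    fix V :: "(real^'m) set set" assume "V \<in> {V. openin torus_top V}"
    then have "open {y. torus_proj y \<in> V}" by (simp add: openin_torus_top)
    moreover have "continuous_on UNIV (\<lambda>y. v + y)" by (intro continuous_intros)
    ultimately have "open ((\<lambda>y. v + y) -` {y. torus_proj y \<in> V})" by (rule open_vimage)
    moreover have "{y. torus_proj y \<in> torus_translate v -` V \<inter> space \<mu>} = (\<lambda>y. v + y) -` {y. torus_proj y \<in> V}"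
      by (auto simp: space_eq torus_translate_proj)
    ultimately have "openin torus_top (torus_translate v -` V \<inter> space \<mu>)"
      by (simp add: openin_torus_top space_eq)
    then show "torus_translate v -` V \<inter> space \<mu> \<in> sets \<mu>"
      by (simp add: sets_eq openin_sets_torus_borel)
  qed
  then show ?thesis using measurable_cong_sets[OF refl sets_eq] by blast
qed

text \<open>Invariance is assumed for images; a preimage under a translation is the image under the
  opposite one.\<close>

lemma distr_translate: "distr \<mu> \<mu> (torus_translate (s *\<^sub>R u)) = \<mu>"
proof (rule measure_eqI)
  fix E assume "E \<in> sets (distr \<mu> \<mu> (torus_translate (s *\<^sub>R u)))"
  then have E: "E \<in> sets \<mu>" by simp
  have sub: "E \<subseteq> range torus_proj" using sets.sets_into_space[OF E] by (simp add: space_eq)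
  have inv: "torus_translate v (torus_translate w c) = torus_translate (v + w) c" for v w and c :: "(real^'m) set"
    by (simp add: torus_translate_def image_image add.assoc)
  have t0: "torus_translate 0 c = c" for c :: "(real^'m) set" by (simp add: torus_translate_def)
  have "torus_translate (s *\<^sub>R u) -` E \<inter> space \<mu> = torus_translate ((- s) *\<^sub>R u) ` E"
  proof (intro set_eqI iffI)
    fix c assume "c \<in> torus_translate (s *\<^sub>R u) -` E \<inter> space \<mu>"
    then show "c \<in> torus_translate ((- s) *\<^sub>R u) ` E"
      by (intro image_eqI[of _ _ "torus_translate (s *\<^sub>R u) c"]) (auto simp: inv t0)
  next
    fix c assume "c \<in> torus_translate ((- s) *\<^sub>R u) ` E"
    then obtain x where x: "x \<in> E" "c = torus_translate ((- s) *\<^sub>R u) x" by blast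
    then obtain y where "x = torus_proj y" using sub by blast
    then have "c \<in> range torus_proj" using x(2) by (simp add: torus_translate_proj)
    then show "c \<in> torus_translate (s *\<^sub>R u) -` E \<inter> space \<mu>"
      using x by (simp add: inv t0 space_eq)
  qed
  then show "emeasure (distr \<mu> \<mu> (torus_translate (s *\<^sub>R u))) E = emeasure \<mu> E"
    using E invariant[OF E, of "- s"] by (simp add: emeasure_distr translate_measurable)
qed simp

text \<open>Translation by half a period along \<open>u\<close> changes the sign of the character
  and preserves the measure.\<close>

lemma integral_chi_eq_0:
  assumes "a \<in> int_vecs" "a \<bullet> u \<noteq> 0"
  shows "(LINT c|\<mu>. chi a c) = 0"
proof -
  define s where "s = 1 / (2 * (a \<bullet> u))"
  have s: "a \<bullet> (s *\<^sub>R u) = 1 / 2" using assms(2) by (simp add: s_def)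
  have "(LINT c|\<mu>. chi a c) = (LINT c|distr \<mu> \<mu> (torus_translate (s *\<^sub>R u)). chi a c)"
    by (simp add: distr_translate)
  also have "\<dots> = (LINT c|\<mu>. chi a (torus_translate (s *\<^sub>R u) c))"
    by (rule integral_distr[OF translate_measurable]) (rule chi_borel[OF assms(1)])
  also have "\<dots> = (LINT c|\<mu>. - chi a c)"
  proof (rule Bochner_Integration.integral_cong[OF refl])
    fix c assume "c \<in> space \<mu>"
    then obtain y where y: "c = torus_proj y" by (auto simp: space_eq)
    have "chi a (torus_translate (s *\<^sub>R u) c) = cis (2 * pi * (a \<bullet> (s *\<^sub>R u)) + 2 * pi * (a \<bullet> y))"
      by (simp only: y torus_translate_proj chi_proj[OF assms(1)] inner_add_right distrib_left)
    also have "\<dots> = cis (2 * pi * (1 / 2)) * cis (2 * pi * (a \<bullet> y))" unfolding s by (rule cis_mult[symmetric])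
    also have "\<dots> = - chi a c" by (simp add: y chi_proj[OF assms(1)])
    finally show "chi a (torus_translate (s *\<^sub>R u) c) = - chi a c" .
  qed
  finally show ?thesis by (simp add: equal_neg_zero)
qed

lemma integrable_bounded_by_1:
  "f \<in> borel_measurable \<mu> \<Longrightarrow> (\<And>x. norm (f x) \<le> B) \<Longrightarrow> integrable \<mu> (f :: _ \<Rightarrow> complex)"
  by (rule integrable_const_bound[of _ B]) auto

definition coef :: "(real^'m) set set \<Rightarrow> real^'m \<Rightarrow> complex" where
  "coef E a = (LINT c|\<mu>. indicat_real E c *\<^sub>R chi a c)"

lemma integrable_ind_chi:
  "E \<in> sets \<mu> \<Longrightarrow> a \<in> int_vecs \<Longrightarrow> integrable \<mu> (\<lambda>c. indicat_real E c *\<^sub>R chi a c)"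
  by (intro integrable_bounded_by_1[of _ 1]) (auto simp: indicator_def)

lemma integrable_chi: "a \<in> int_vecs \<Longrightarrow> integrable \<mu> (chi a)"
  by (intro integrable_bounded_by_1[of _ 1]) auto

lemma coef_0: "E \<in> sets \<mu> \<Longrightarrow> coef E 0 = of_real (prob E)"
  by (simp add: coef_def scaleR_conv_of_real)

text \<open>Characters of distinct frequency are orthonormal, because the quotient of two of them
  has nonzero frequency and integral zero. Characters of equal frequency need not be orthogonal,
  hence the injectivity on \<open>S\<close>.\<close>

lemma bessel:
  assumes E: "E \<in> sets \<mu>" and S: "finite S" "S \<subseteq> int_vecs" "inj_on (\<lambda>a. a \<bullet> u) S"
  shows "(\<Sum>a\<in>S. (norm (coef E a))\<^sup>2) \<le> 1"
proof -
  define f where "f c = complex_of_real (indicat_real E c)" for c :: "(real^'m) set"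
  \<comment> \<open>The orthogonal projection of the indicator onto the span of the characters:
    \<open>coef\<close> integrates against \<open>chi a\<close> itself, so the Fourier coefficient
    of the real function \<open>f\<close> is its conjugate.\<close>
  define P where "P c = (\<Sum>a\<in>S. cnj (coef E a) * chi a c)" for c
  let ?s = "\<Sum>a\<in>S. (norm (coef E a))\<^sup>2"
  have int_f_chi: "integrable \<mu> (\<lambda>c. f c * chi a c)" "(LINT c|\<mu>. f c * chi a c) = coef E a" if "a \<in> S" for a
    using integrable_ind_chi[OF E, of a] S(2) that by (auto simp: f_def coef_def scaleR_conv_of_real)
  have fcnj: "f c * cnj (chi a c) = cnj (f c * chi a c)" for a c by (simp add: f_def)
  have int_fP: "integrable \<mu> (\<lambda>c. f c * P c)"
    using int_f_chi by (simp add: P_def sum_distrib_left mult.left_commute[of "f _"])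
  have fP: "(LINT c|\<mu>. f c * P c) = of_real ?s"
  proof -
    have "(LINT c|\<mu>. f c * P c) = (\<Sum>a\<in>S. cnj (coef E a) * (LINT c|\<mu>. f c * chi a c))"
      using int_f_chi by (simp add: P_def sum_distrib_left mult.left_commute[of "f _"])
    also have "\<dots> = of_real ?s"
      unfolding of_real_sum
      by (intro sum.cong refl) (simp only: int_f_chi(2) complex_norm_square mult.commute)
    finally show ?thesis .
  qed
  have PP: "P c * cnj (P c) = (\<Sum>a\<in>S. \<Sum>b\<in>S. (cnj (coef E a) * coef E b) * chi (a - b) c)" for c
    by (simp add: P_def sum_product mult.assoc mult.left_commute[of "chi _ _"] flip: chi_mult_cnj)
  have intab: "integrable \<mu> (chi (a - b))" if "a \<in> S" "b \<in> S" for a b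
    using that S(2) int_vecs_diff by (intro integrable_chi) blast
  have int_PP: "integrable \<mu> (\<lambda>c. P c * cnj (P c))"
    unfolding PP using intab by (intro Bochner_Integration.integrable_sum integrable_mult_right) auto
  have IPP: "(LINT c|\<mu>. P c * cnj (P c)) = of_real ?s"
  proof -
    have "(LINT c|\<mu>. P c * cnj (P c)) = (\<Sum>a\<in>S. \<Sum>b\<in>S. (cnj (coef E a) * coef E b) * (LINT c|\<mu>. chi (a - b) c))"
      unfolding PP using intab by (subst Bochner_Integration.integral_sum)
        (auto intro!: Bochner_Integration.integrable_sum sum.cong simp: Bochner_Integration.integral_sum)
    also have "\<dots> = (\<Sum>a\<in>S. \<Sum>b\<in>S. if a = b then of_real ((norm (coef E a))\<^sup>2) else 0)"
    proof (intro sum.cong refl)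
      fix a b assume ab: "a \<in> S" "b \<in> S"
      show "(cnj (coef E a) * coef E b) * (LINT c|\<mu>. chi (a - b) c) = (if a = b then of_real ((norm (coef E a))\<^sup>2) else 0)"
      proof (cases "a = b")
        case True
        have "cnj (coef E b) * coef E b = of_real ((norm (coef E b))\<^sup>2)"
          by (simp only: complex_norm_square mult.commute)
        then show ?thesis using True by (simp add: prob_space)
      next
        case False
        then have "(a - b) \<bullet> u \<noteq> 0" using S(3) ab by (auto simp: inj_on_def inner_diff_left)
        then have "(LINT c|\<mu>. chi (a - b) c) = 0"
          using ab S(2) int_vecs_diff by (intro integral_chi_eq_0) blast+
        then show ?thesis using False by simp
      qed
    qed
    also have "\<dots> = of_real ?s" using S(1) by (simp add: sum.delta)
    finally show ?thesis .
  qed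
  have int_f: "integrable \<mu> f"
    using E unfolding f_def by (intro integrable_bounded_by_1[of _ 1] borel_measurable_of_real
        borel_measurable_indicator) (auto simp: indicator_def)
  have I_f: "(LINT c|\<mu>. f c) = of_real (prob E)"
    using E by (simp add: f_def)
  have ff: "f c * f c = f c" for c by (simp add: f_def indicator_def)
  have eq: "of_real ((norm (f c - P c))\<^sup>2) = f c - f c * P c - cnj (f c * P c) + P c * cnj (P c)" for c
    unfolding complex_norm_square by (simp add: algebra_simps ff) (simp add: f_def indicator_def)
  have "(LINT c|\<mu>. complex_of_real ((norm (f c - P c))\<^sup>2)) = of_real (prob E) - of_real ?s - cnj (of_real ?s) + of_real ?s"
  proof -
    have "integrable \<mu> (\<lambda>c. cnj (f c * P c))" using int_fP by (rule Bochner_Integration.integrable_cnj)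
    then have "(LINT c|\<mu>. f c - f c * P c - cnj (f c * P c) + P c * cnj (P c)) =
        (LINT c|\<mu>. f c) - (LINT c|\<mu>. f c * P c) - (LINT c|\<mu>. cnj (f c * P c)) + (LINT c|\<mu>. P c * cnj (P c))"
      using int_f int_fP int_PP by (simp del: complex_cnj_mult)
    then show ?thesis unfolding eq Bochner_Integration.integral_cnj I_f fP IPP .
  qed
  also have "\<dots> = of_real (prob E - ?s)" by simp
  finally have "complex_of_real (LINT c|\<mu>. (norm (f c - P c))\<^sup>2) = of_real (prob E - ?s)"
    by (simp only: integral_complex_of_real)
  then have "(LINT c|\<mu>. (norm (f c - P c))\<^sup>2) = prob E - ?s"
    by (simp only: of_real_eq_iff)
  moreover have "0 \<le> (LINT c|\<mu>. (norm (f c - P c))\<^sup>2)" by simp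
  ultimately show ?thesis using prob_le_1[of E] by linarith
qed

text \<open>Frequencies are counted, not characters, since infinitely many characters may share a
  frequency. One representative for each frequency gives a family for \<open>bessel\<close>, which
  leaves room for at most \<open>1 / \<delta>\<^sup>2\<close> of them.\<close>

lemma finite_large_coef:
  assumes E: "E \<in> sets \<mu>" and \<delta>: "0 < \<delta>"
  shows "finite {a \<bullet> u |a. a \<in> int_vecs \<and> \<delta> \<le> norm (coef E a)}" (is "finite ?C")
proof (rule ccontr)
  assume "infinite ?C"
  obtain n :: nat where n: "1 / \<delta>\<^sup>2 < real n" using reals_Archimedean2 by blast
  obtain D where D: "D \<subseteq> ?C" "finite D" "card D = n"
    using infinite_arbitrarily_large[OF \<open>infinite ?C\<close>] by blast
  have "\<forall>x\<in>D. \<exists>a. a \<in> int_vecs \<and> \<delta> \<le> norm (coef E a) \<and> a \<bullet> u = x" using D(1) by blast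
  then obtain r where r: "\<And>x. x \<in> D \<Longrightarrow> r x \<in> int_vecs \<and> \<delta> \<le> norm (coef E (r x)) \<and> r x \<bullet> u = x" by metis
  have inj: "inj_on r D" using r by (metis inj_onI)
  have "real n * \<delta>\<^sup>2 = (\<Sum>a\<in>r ` D. \<delta>\<^sup>2)" using D inj by (simp add: card_image)
  also have "\<dots> \<le> (\<Sum>a\<in>r ` D. (norm (coef E a))\<^sup>2)"
    using r \<delta> by (intro sum_mono power_mono) auto
  also have "\<dots> \<le> 1"
  proof (rule bessel[OF E])
    show "inj_on (\<lambda>a. a \<bullet> u) (r ` D)" using r by (auto simp: inj_on_def)
  qed (use D r in auto)
  finally show False using n \<delta> by (simp add: field_simps)
qed

end

section \<open>A product binomial kernel\<close>

lemma prod_cis: "(\<Prod>i\<in>A. cis (f i)) = cis (\<Sum>i\<in>A. f i)"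
  by (induction A rule: infinite_finite_induct) (simp_all add: cis_mult)

text \<open>The law of independent binomial variables with parameters \<open>N\<close> and 1/2;
  these are the coefficients of the kernel.\<close>

definition weight :: "nat \<Rightarrow> ('d::finite \<Rightarrow> nat) \<Rightarrow> real" where
  "weight N J = (\<Prod>i\<in>UNIV. real (N choose J i) / 2 ^ N)"

definition nvec :: "('d \<Rightarrow> nat) \<Rightarrow> real^'d" where
  "nvec J = (\<chi> i. real (J i))"

lemma nvec_int: "nvec J \<in> int_vecs"
  by (simp add: nvec_def int_vecs_def)

lemma weight_nonneg: "0 \<le> weight N J"
  unfolding weight_def by (intro prod_nonneg) simp

lemma binomial_kernel_expand:
  fixes x :: "real^'d"
  shows "(\<Prod>i\<in>UNIV. ((1 + cis (2 * pi * x $ i)) / 2) ^ N) =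
    (\<Sum>J\<in>PiE UNIV (\<lambda>_. {..N}). of_real (weight N J) * cis (2 * pi * (nvec J \<bullet> x)))"
proof -
  have "((1 + cis (2 * pi * x $ i)) / 2) ^ N =
      (\<Sum>j\<le>N. of_real (real (N choose j) / 2 ^ N) * cis (2 * pi * (real j * x $ i)))" for i
  proof -
    have "(cis (2 * pi * x $ i) + 1) ^ N = (\<Sum>j\<le>N. of_nat (N choose j) * cis (2 * pi * (real j * x $ i)))"
      unfolding binomial_ring by (simp add: Complex.DeMoivre mult.left_commute)
    then show ?thesis
      by (simp add: power_divide add.commute sum_divide_distrib)
  qed
  then have "(\<Prod>i\<in>UNIV. ((1 + cis (2 * pi * x $ i)) / 2) ^ N) =
      (\<Prod>i\<in>UNIV. \<Sum>j\<le>N. of_real (real (N choose j) / 2 ^ N) * cis (2 * pi * (real j * x $ i)))"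
    by simp
  also have "\<dots> = (\<Sum>J\<in>PiE UNIV (\<lambda>_. {..N}). \<Prod>i\<in>UNIV. of_real (real (N choose J i) / 2 ^ N) * cis (2 * pi * (real (J i) * x $ i)))"
    by (intro prod_sum_PiE) auto
  also have "\<dots> = (\<Sum>J\<in>PiE UNIV (\<lambda>_. {..N}). of_real (weight N J) * cis (2 * pi * (nvec J \<bullet> x)))"
    by (simp only: prod.distrib prod_cis of_real_prod[symmetric] weight_def[symmetric])
       (simp add: inner_vec_def nvec_def sum_distrib_left)
  finally show ?thesis .
qed

text \<open>The value of the kernel at the origin, where every factor is one.\<close>

lemma sum_weight: "(\<Sum>J\<in>PiE (UNIV :: 'd::finite set) (\<lambda>_. {..N}). weight N J) = 1"
proof -
  have "complex_of_real (\<Sum>J\<in>PiE (UNIV :: 'd set) (\<lambda>_. {..N}). weight N J) = 1"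
    using binomial_kernel_expand[of "0 :: real^'d" N] by simp
  then show ?thesis by (metis of_real_eq_1_iff)
qed

lemma norm_half_cis: "(norm ((1 + cis \<phi>) / 2))\<^sup>2 = (1 + cos \<phi>) / 2"
proof -
  have "(1 + cos \<phi>)\<^sup>2 + (sin \<phi>)\<^sup>2 = 2 + 2 * cos \<phi>"
    using sin_cos_squared_add[of \<phi>] by (simp add: power2_eq_square algebra_simps)
  then show ?thesis by (simp add: norm_divide power_divide cmod_power2)
qed

text \<open>Up to sign and an integer, \<open>x\<close> is its distance to the nearest integer, and
  cosine decreases on [0, pi].\<close>

lemma cos_away_from_Ints:
  assumes "0 \<le> r" "r \<le> 1 / 2" "r \<le> \<bar>x - of_int (round x)\<bar>"
  shows "cos (2 * pi * x) \<le> cos (2 * pi * r)"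
proof -
  let ?y = "\<bar>x - of_int (round x)\<bar>"
  have y: "?y \<le> 1 / 2" using of_int_round_abs_le[of x] by (simp add: abs_minus_commute)
  have "cos (2 * pi * x) = cos (2 * pi * (x - of_int (round x)) + 2 * pi * of_int (round x))"
    by (simp add: algebra_simps)
  also have "\<dots> = cos (2 * pi * (x - of_int (round x)))"
    by (simp add: cos_add)
  also have "\<dots> = cos (2 * pi * ?y)"
    by (simp add: abs_if minus_mult_right[symmetric])  (metis cos_minus minus_diff_eq mult_minus_right)
  also have "\<dots> \<le> cos (2 * pi * r)"
    using assms y pi_gt_zero by (subst cos_mono_le_eq) auto
  finally show ?thesis .
qed

text \<open>A \<open>D\<close>-th root reduces the claim to the convergence of
  \<open>n * s ^ n\<close> to zero.\<close>

lemma geometric_beats_polynomial: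
  fixes \<theta> :: real
  assumes "0 \<le> \<theta>" "\<theta> < 1" "0 < D"
  obtains N :: nat where "\<theta> ^ N * (real N + 1) ^ D < 1 / 2"
proof -
  \<comment> \<open>The maximum keeps the base positive even for \<open>\<theta> = 0\<close>, so
    that its root is positive and a factor \<open>q\<close> can be cancelled.\<close>
  define q where "q = max \<theta> (1 / 2)"
  have q: "0 < q" "q < 1" "\<theta> \<le> q" using assms by (auto simp: q_def)
  define s where "s = root D q"
  have s: "0 < s" "s < 1" "s ^ D = q" using q assms(3) by (auto simp: s_def)
  have "(\<lambda>n. real n * s ^ n) \<longlonglongrightarrow> 0" using s by (intro powser_times_n_limit_0) auto
  then have "(\<lambda>n. real (Suc n) * s ^ Suc n) \<longlonglongrightarrow> 0" by (rule LIMSEQ_Suc)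
  then have "(\<lambda>n. (real (Suc n) * s ^ Suc n) ^ D) \<longlonglongrightarrow> 0 ^ D" by (intro tendsto_intros)
  then have "(\<lambda>n. (real (Suc n) * s ^ Suc n) ^ D) \<longlonglongrightarrow> 0" using assms(3) by (simp add: power_0_left)
  then have "\<forall>\<^sub>F n in sequentially. (real (Suc n) * s ^ Suc n) ^ D < q / 2"
    by (rule order_tendstoD) (use q in simp)
  then obtain N where N: "(real (Suc N) * s ^ Suc N) ^ D < q / 2"
    using eventually_happens'[OF sequentially_bot] by blast
  have "(s ^ Suc N) ^ D = q ^ Suc N" using s(3) by (metis power_mult mult.commute)
  then have "(real (Suc N) * s ^ Suc N) ^ D = (real N + 1) ^ D * q ^ N * q"
    by (simp only: power_mult_distrib power_Suc2 of_nat_Suc mult.assoc add.commute)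
  then have "(real N + 1) ^ D * q ^ N * q < q * (1 / 2)" using N by simp
  then have "(real N + 1) ^ D * q ^ N < 1 / 2"
    using q(1) by (metis mult.commute mult_less_cancel_left_pos)
  moreover have "\<theta> ^ N \<le> q ^ N" using q(3) assms(1) by (rule power_mono)
  then have "\<theta> ^ N * (real N + 1) ^ D \<le> q ^ N * (real N + 1) ^ D" by (intro mult_right_mono) auto
  ultimately have "\<theta> ^ N * (real N + 1) ^ D < 1 / 2" by (metis mult.commute order_le_less_trans)
  then show ?thesis by (rule that)
qed

context line_invariant
begin

text \<open>Integrating the nonnegative trigonometric polynomial \<open>|\<Prod>((1 + e(x\<^sub>i)) / 2)\<^sup>N|\<^sup>2\<close> over \<open>E\<close>: the
  constant term is at least \<open>(N + 1)\<^sup>-\<^sup>d\<close> times the measure of \<open>E\<close> and the other terms are small, whereas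
  off a neighbourhood of the integer vectors the polynomial decays exponentially in \<open>N\<close>.\<close>

lemma equidistribution_hits_ball:
  assumes E: "E \<in> sets \<mu>" "0 < prob E" and \<rho>: "0 < \<rho>"
  obtains F :: "(real^'d) set" and C where "finite F" "F \<subseteq> int_vecs - {0}" "finite C"
    "\<forall>Q b. (\<forall>i j. Q $ i $ j \<in> \<int>) \<longrightarrow> (\<forall>z\<in>F. z \<bullet> (Q *v u) \<notin> C) \<longrightarrow>
       (\<exists>y. torus_proj y \<in> E \<and> (\<exists>p\<in>int_vecs. norm (Q *v y - b - p) < \<rho>))"
proof -
  let ?D = "CARD('d)"
  \<comment> \<open>If all coordinates are within \<open>r\<close> of integers, the point is within
    \<open>D * r < \<rho>\<close> of an integer vector. The bound 1/4 keeps
    \<open>2 * pi * r\<close> where cosine is strictly decreasing.\<close>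
  define r where "r = min (\<rho> / (2 * real ?D)) (1 / 4)"
  have r: "0 < r" "r \<le> 1 / 4" "real ?D * r < \<rho>"
    using \<rho> by (auto simp: r_def min_def field_simps)
  define \<theta> where "\<theta> = (1 + cos (2 * pi * r)) / 2"
  have \<theta>: "0 \<le> \<theta>" "\<theta> < 1"
  proof -
    show "0 \<le> \<theta>" using add_left_mono[OF cos_ge_minus_one[of "2 * pi * r"], of 1] by (simp add: \<theta>_def)
    have "cos (2 * pi * r) < cos 0" using r pi_gt_zero by (intro cos_monotone_0_pi) auto
    then show "\<theta> < 1" by (simp add: \<theta>_def)
  qed
  obtain N where N: "\<theta> ^ N * (real N + 1) ^ ?D < 1 / 2"
    using geometric_beats_polynomial[OF \<theta>] zero_less_card_finite[where 'a='d] by metis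
  let ?J = "PiE (UNIV :: 'd set) (\<lambda>_. {..N})"
  have finJ: "finite ?J" by (intro finite_PiE) auto
  have cJ: "real (card ?J) = (real N + 1) ^ ?D" by (simp add: card_PiE add.commute)
  have cJ0: "0 < real (card ?J)" unfolding cJ by simp
  \<comment> \<open>Half of \<open>prob E / card ?J\<close>, the lower bound for the diagonal. As
    the weights sum to one, the off-diagonal terms cost at most \<delta> altogether.\<close>
  define \<delta> where "\<delta> = prob E / (2 * real (card ?J))"
  have \<delta>: "0 < \<delta>" using E(2) cJ0 by (simp add: \<delta>_def)
  \<comment> \<open>Zero belongs to \<open>C\<close>, since \<open>coef E 0\<close> is
    \<open>prob E\<close>. Avoiding \<open>C\<close> therefore also prevents different exponents
    from pulling back to the same character.\<close>
  define C where "C = {a \<bullet> u |a. a \<in> int_vecs \<and> \<delta> \<le> norm (coef E a)}"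
  \<comment> \<open>Differences of exponents of the kernel. Neither \<open>F\<close> nor
    \<open>C\<close> depends on \<open>Q\<close> or \<open>b\<close>, so both can be fixed before
    the matrix is known.\<close>
  define F where "F = (\<lambda>(J, K). nvec J - nvec K :: real^'d) ` {p \<in> ?J \<times> ?J. fst p \<noteq> snd p}"
  have "\<exists>y. torus_proj y \<in> E \<and> (\<exists>p\<in>int_vecs. norm (Q *v y - b - p) < \<rho>)"
    if Q: "\<And>i j. Q $ i $ j \<in> \<int>" and QC: "\<And>z. z \<in> F \<Longrightarrow> z \<bullet> (Q *v u) \<notin> C"
    for Q :: "real^'m^'d" and b
  proof (rule ccontr)
    assume none: "\<not> ?thesis"
    \<comment> \<open>Composing the kernel with \<open>Q *v y - b\<close> yields a trigonometric
      polynomial on the torus: the exponents move to \<open>a J\<close>, and \<open>b\<close> only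
      contributes phases to \<open>k J\<close>.\<close>
    define a where "a J = transpose Q *v nvec J" for J :: "'d \<Rightarrow> nat"
    have a_int: "a J \<in> int_vecs" for J
      unfolding a_def by (rule int_matrix_mult) (simp_all add: transpose_def Q nvec_int)
    define k where "k J = of_real (weight N J) * cis (- (2 * pi * (nvec J \<bullet> b)))" for J
    define \<Phi> where "\<Phi> c = (\<Sum>J\<in>?J. k J * chi (a J) c)" for c
    have \<Phi>: "\<Phi> (torus_proj y) = (\<Prod>i\<in>UNIV. ((1 + cis (2 * pi * (Q *v y - b) $ i)) / 2) ^ N)" for y
    proof -
      have "k J * chi (a J) (torus_proj y) = of_real (weight N J) * cis (2 * pi * (nvec J \<bullet> (Q *v y - b)))" for J
        unfolding k_def chi_proj[OF a_int]
        by (simp add: mult.assoc cis_mult a_def inner_diff_right inner_matrix_mult algebra_simps)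
      then show ?thesis unfolding \<Phi>_def binomial_kernel_expand by simp
    qed
    have small: "(norm (\<Phi> c))\<^sup>2 \<le> \<theta> ^ N" if c: "c \<in> E" for c
    proof -
      have "c \<in> range torus_proj" using c sets.sets_into_space[OF E(1)] space_eq by blast
      then obtain y where y: "c = torus_proj y" by blast
      define x where "x = Q *v y - b"
      define p :: "real^'d" where "p = (\<chi> i. of_int (round (x $ i)))"
      have "p \<in> int_vecs" by (simp add: p_def int_vecs_def)
      then have "\<rho> \<le> norm (x - p)" using none c unfolding y x_def by (meson not_less)
      also have "\<dots> \<le> (\<Sum>i\<in>UNIV. \<bar>(x - p) $ i\<bar>)" by (rule norm_le_l1_cart)
      finally have "\<rho> \<le> (\<Sum>i\<in>UNIV. \<bar>(x - p) $ i\<bar>)" .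
      have "\<exists>i. r \<le> \<bar>(x - p) $ i\<bar>"
      proof (rule ccontr)
        assume "\<not> ?thesis"
        then have "(\<Sum>i\<in>UNIV. \<bar>(x - p) $ i\<bar>) \<le> (\<Sum>i\<in>(UNIV :: 'd set). r)"
          by (intro sum_mono) (simp add: not_le less_imp_le)
        then show False using \<open>\<rho> \<le> (\<Sum>i\<in>UNIV. \<bar>(x - p) $ i\<bar>)\<close> r(3) by simp
      qed
      then obtain i where "r \<le> \<bar>(x - p) $ i\<bar>" by blast
      then have "cos (2 * pi * x $ i) \<le> cos (2 * pi * r)"
        using r by (intro cos_away_from_Ints) (auto simp: p_def)
      then have i: "(1 + cos (2 * pi * x $ i)) / 2 \<le> \<theta>" by (simp add: \<theta>_def)
      have nn: "0 \<le> (1 + cos t) / 2" "(1 + cos t) / 2 \<le> 1" for t :: real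
        using add_left_mono[OF cos_ge_minus_one[of t], of 1] cos_le_one[of t] by simp_all
      have "(norm (\<Phi> c))\<^sup>2 = (\<Prod>j\<in>UNIV. ((1 + cos (2 * pi * x $ j)) / 2) ^ N)"
        unfolding y \<Phi> x_def[symmetric]
        by (simp only: prod_norm[symmetric] prod_power_distrib norm_power power_commutes
              power_mult[symmetric] mult.commute[of N] power_mult norm_half_cis)
      also have "\<dots> = ((1 + cos (2 * pi * x $ i)) / 2) ^ N * (\<Prod>j\<in>UNIV - {i}. ((1 + cos (2 * pi * x $ j)) / 2) ^ N)"
        by (rule prod.remove) auto
      also have "\<dots> \<le> \<theta> ^ N * 1"
        using i nn \<theta>(1) by (intro mult_mono power_mono prod_le_1 prod_nonneg conjI zero_le_power power_le_one) auto
      finally show ?thesis by simp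
    qed
    have \<Phi>\<Phi>: "indicat_real E c *\<^sub>R (\<Phi> c * cnj (\<Phi> c)) =
        (\<Sum>J\<in>?J. \<Sum>K\<in>?J. (k J * cnj (k K)) * (indicat_real E c *\<^sub>R chi (a J - a K) c))" for c
      by (simp add: \<Phi>_def sum_product scaleR_sum_right chi_mult_cnj[symmetric] mult_ac)
    have int: "integrable \<mu> (\<lambda>c. indicat_real E c *\<^sub>R chi (a J - a K) c)" for J K
      by (intro integrable_ind_chi E int_vecs_diff a_int)
    have intPP: "integrable \<mu> (\<lambda>c. indicat_real E c *\<^sub>R (\<Phi> c * cnj (\<Phi> c)))"
      unfolding \<Phi>\<Phi> using int by (intro Bochner_Integration.integrable_sum integrable_mult_right) auto
    have I: "(LINT c|\<mu>. indicat_real E c *\<^sub>R (\<Phi> c * cnj (\<Phi> c))) =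
        (\<Sum>J\<in>?J. \<Sum>K\<in>?J. (k J * cnj (k K)) * coef E (a J - a K))"
    proof -
      have int2: "integrable \<mu> (\<lambda>c. m * (indicat_real E c *\<^sub>R chi (a J - a K) c))" for m J K
        by (intro integrable_mult_right int)
      show ?thesis
        unfolding \<Phi>\<Phi> coef_def
        by (subst Bochner_Integration.integral_sum, intro Bochner_Integration.integrable_sum int2,
            intro sum.cong refl, subst Bochner_Integration.integral_sum, rule int2,
            intro sum.cong refl integral_mult_right_zero)
    qed
    have "Re (LINT c|\<mu>. indicat_real E c *\<^sub>R (\<Phi> c * cnj (\<Phi> c))) = (LINT c|\<mu>. indicat_real E c * (norm (\<Phi> c))\<^sup>2)"
      using intPP by (subst integral_Re[symmetric]) (auto simp flip: complex_norm_square)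
    also have "\<dots> \<le> (LINT c|\<mu>. \<theta> ^ N * indicat_real E c)"
    proof (rule integral_mono_AE)
      show "integrable \<mu> (\<lambda>c. indicat_real E c * (norm (\<Phi> c))\<^sup>2)"
        using integrable_Re[OF intPP] by (simp flip: complex_norm_square)
      show "integrable \<mu> (\<lambda>c. \<theta> ^ N * indicat_real E c)"
        using E(1) by (intro integrable_mult_right) (simp add: integrable_indicator_iff emeasure_eq_measure)
    qed (use small in \<open>auto simp: indicator_def\<close>)
    also have "\<dots> = \<theta> ^ N * prob E" using E(1) by simp
    finally have up: "Re (LINT c|\<mu>. indicat_real E c *\<^sub>R (\<Phi> c * cnj (\<Phi> c))) \<le> \<theta> ^ N * prob E" .
    have pair_term: "(if J = K then (weight N J)\<^sup>2 * prob E else 0) - weight N J * weight N K * \<delta>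
        \<le> Re ((k J * cnj (k K)) * coef E (a J - a K))" if JK: "J \<in> ?J" "K \<in> ?J" for J K
    proof (cases "J = K")
      case True
      have "k J * cnj (k J) = of_real ((weight N J)\<^sup>2)"
        by (simp add: k_def cis_cnj cis_mult power2_eq_square mult_ac)
      then have "Re ((k J * cnj (k K)) * coef E (a J - a K)) = (weight N J)\<^sup>2 * prob E"
        using True E(1) by (simp add: coef_0)
      moreover have "0 \<le> weight N J * weight N K * \<delta>"
        using \<delta> weight_nonneg by (intro mult_nonneg_nonneg) auto
      ultimately show ?thesis using True by simp
    next
      case False
      have "nvec J - nvec K \<in> F" unfolding F_def using JK False by force
      then have "(nvec J - nvec K) \<bullet> (Q *v u) \<notin> C" by (rule QC)
      then have "(a J - a K) \<bullet> u \<notin> C"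
        by (simp add: a_def inner_matrix_mult matrix_vector_mult_diff_distrib)
      moreover have "a J - a K \<in> int_vecs" by (intro int_vecs_diff a_int)
      ultimately have "norm (coef E (a J - a K)) < \<delta>" unfolding C_def by force
      moreover have "norm (k J * cnj (k K)) = weight N J * weight N K"
        by (simp add: k_def norm_mult weight_nonneg)
      ultimately have "norm ((k J * cnj (k K)) * coef E (a J - a K)) \<le> weight N J * weight N K * \<delta>"
        unfolding norm_mult[of "k J * cnj (k K)"] by (intro mult_mono) (auto simp: weight_nonneg)
      then show ?thesis using False abs_Re_le_cmod[of "(k J * cnj (k K)) * coef E (a J - a K)"] by simp
    qed
    have "(\<Sum>J\<in>?J. (weight N J)\<^sup>2) * prob E - \<delta> =
        (\<Sum>J\<in>?J. \<Sum>K\<in>?J. (if J = K then (weight N J)\<^sup>2 * prob E else 0) - weight N J * weight N K * \<delta>)"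
    proof -
      have "(\<Sum>J\<in>?J. \<Sum>K\<in>?J. weight N J * weight N K * \<delta>) = (\<Sum>J\<in>?J. weight N J) * (\<Sum>K\<in>?J. weight N K) * \<delta>"
        by (simp only: sum_product) (simp only: sum_distrib_right)
      then show ?thesis
        using finJ by (simp add: sum_subtractf sum.delta sum_distrib_right sum_weight)
    qed
    also have "\<dots> \<le> (\<Sum>J\<in>?J. \<Sum>K\<in>?J. Re ((k J * cnj (k K)) * coef E (a J - a K)))"
      by (intro sum_mono pair_term)
    also have "\<dots> = Re (LINT c|\<mu>. indicat_real E c *\<^sub>R (\<Phi> c * cnj (\<Phi> c)))" unfolding I by simp
    finally have low: "(\<Sum>J\<in>?J. (weight N J)\<^sup>2) * prob E - \<delta> \<le> \<theta> ^ N * prob E" using up by linarith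
    have "(\<Sum>J\<in>?J. weight N J)\<^sup>2 \<le> (\<Sum>J\<in>?J. (1::real)\<^sup>2) * (\<Sum>J\<in>?J. (weight N J)\<^sup>2)"
      using Cauchy_Schwarz_ineq_sum[of "\<lambda>_. 1" "weight N" ?J] by simp
    then have "1 \<le> real (card ?J) * (\<Sum>J\<in>?J. (weight N J)\<^sup>2)" by (simp add: sum_weight)
    then have "1 / real (card ?J) \<le> (\<Sum>J\<in>?J. (weight N J)\<^sup>2)" using cJ0 by (simp add: field_simps)
    then have "1 / real (card ?J) * prob E \<le> (\<Sum>J\<in>?J. (weight N J)\<^sup>2) * prob E"
      using E(2) by (intro mult_right_mono) auto
    then have "prob E * (1 / (2 * real (card ?J))) \<le> prob E * \<theta> ^ N"
      using low by (simp add: \<delta>_def mult.commute)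
    then have "1 / (2 * real (card ?J)) \<le> \<theta> ^ N"
      using E(2) by (simp only: mult_le_cancel_left_pos)
    then have "1 / 2 \<le> \<theta> ^ N * real (card ?J)" using cJ0 by (simp add: field_simps)
    then show False using N unfolding cJ by simp
  qed
  moreover have "finite F" unfolding F_def using finJ by auto
  moreover have "F \<subseteq> int_vecs - {0}"
    unfolding F_def using int_vecs_diff[OF nvec_int nvec_int] by (auto simp: nvec_def vec_eq_iff fun_eq_iff)
  moreover have "finite C" unfolding C_def by (rule finite_large_coef[OF E(1) \<delta>])
  ultimately show ?thesis using that[of F C] by blast
qed

end

section \<open>Badly approximable targets\<close>

lemma is_norm_zero: "is_norm N \<Longrightarrow> N 0 = 0"
  and is_norm_scale: "is_norm N \<Longrightarrow> N (c *\<^sub>R x) = \<bar>c\<bar> * N x"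
  and is_norm_triangle: "is_norm N \<Longrightarrow> N (x + y) \<le> N x + N y"
  by (simp_all add: is_norm_def)

lemma is_norm_minus: "is_norm N \<Longrightarrow> N (- x) = N x"
  using is_norm_scale[of N "- 1" x] by simp

lemma is_norm_pos: "is_norm N \<Longrightarrow> x \<noteq> 0 \<Longrightarrow> 0 < N x"
  using is_norm_nonneg[of N x] by (simp add: is_norm_def less_le)

lemma is_norm_diff: "is_norm N \<Longrightarrow> \<bar>N x - N y\<bar> \<le> N (x - y)"
  using is_norm_triangle[of N "x - y" y] is_norm_triangle[of N "y - x" x] is_norm_minus[of N "x - y"]
  by simp

lemma is_norm_le_norm:
  fixes N :: "real^'k \<Rightarrow> real"
  assumes "is_norm N"
  obtains B where "0 < B" "\<forall>x. N x \<le> B * norm x"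
proof -
  have sum: "N (\<Sum>i\<in>I. f i) \<le> (\<Sum>i\<in>I. N (f i))" for f :: "'k \<Rightarrow> real^'k" and I
  proof (induction I rule: infinite_finite_induct)
    case (insert i I)
    then show ?case using is_norm_triangle[OF assms, of "f i" "\<Sum>i\<in>I. f i"] by simp
  qed (simp_all add: is_norm_zero[OF assms])
  let ?B = "\<Sum>i\<in>UNIV. N (axis i 1)"
  have nn: "0 \<le> ?B" by (intro sum_nonneg is_norm_nonneg[OF assms])
  have "N x \<le> (?B + 1) * norm x" for x
  proof -
    have "N x = N (\<Sum>i\<in>UNIV. x $ i *\<^sub>R axis i 1)"
      using basis_expansion[of x] by (simp add: scalar_mult_eq_scaleR)
    also have "\<dots> \<le> (\<Sum>i\<in>UNIV. N (x $ i *\<^sub>R axis i 1))" by (rule sum)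
    also have "\<dots> \<le> (\<Sum>i\<in>UNIV. norm x * N (axis i 1))"
      by (intro sum_mono) (simp add: is_norm_scale[OF assms] mult_right_mono component_le_norm_cart is_norm_nonneg[OF assms])
    also have "\<dots> \<le> (?B + 1) * norm x" by (simp add: sum_distrib_left[symmetric] algebra_simps)
    finally show ?thesis .
  qed
  then show ?thesis using that[of "?B + 1"] nn by simp
qed

lemma is_norm_continuous:
  fixes N :: "real^'k \<Rightarrow> real"
  assumes "is_norm N"
  shows "continuous_on UNIV N"
proof -
  obtain B where B: "0 < B" "\<forall>x. N x \<le> B * norm x" using is_norm_le_norm[OF assms] .
  have "dist (N x) (N y) \<le> B * dist x y" for x y
    using is_norm_diff[OF assms, of x y] B(2)[rule_format, of "x - y"] by (simp add: dist_norm)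
  then have "B-lipschitz_on UNIV N" using B(1) by (intro lipschitz_onI) auto
  then show ?thesis by (rule lipschitz_on_continuous_on)
qed

text \<open>One condition for each \<open>p\<close> replaces the distance to the integers, so the
  set is visibly closed. Countably many pairs \<open>(\<epsilon>, R)\<close> exhaust the positivity
  of the lower limit.\<close>

definition bad_bound ::
  "(real^'m \<Rightarrow> real) \<Rightarrow> (real^'n \<Rightarrow> real) \<Rightarrow> real^'n^'m \<Rightarrow> real \<Rightarrow> real \<Rightarrow> real^'m \<Rightarrow> bool" where
  "bad_bound Nm Nn A \<epsilon> R y \<longleftrightarrow> (\<forall>q\<in>int_vecs. R \<le> Nn q \<longrightarrow>
     (\<forall>p\<in>int_vecs. \<epsilon> \<le> Nn q powr (real CARD('n) / real CARD('m)) * Nm (A *v q - y - p)))"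

lemma le_mult_dist_int_iff:
  fixes N :: "real^'k \<Rightarrow> real"
  assumes "is_norm N" "0 \<le> c"
  shows "\<epsilon> \<le> c * dist_int N z \<longleftrightarrow> (\<forall>p\<in>int_vecs. \<epsilon> \<le> c * N (z - p))"
proof -
  have ne: "int_vecs \<noteq> ({} :: (real^'k) set)" using zero_int_vecs by blast
  show ?thesis
  proof (cases "c = 0")
    case True
    then show ?thesis using ne by auto
  next
    case False
    then have c: "0 < c" using assms(2) by simp
    have "bdd_below ((\<lambda>p. N (z - p)) ` int_vecs)"
      using is_norm_nonneg[OF assms(1)] by (intro bdd_belowI[of _ 0]) auto
    with ne have "\<epsilon> / c \<le> dist_int N z \<longleftrightarrow> (\<forall>p\<in>int_vecs. \<epsilon> / c \<le> N (z - p))"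
      unfolding dist_int_def by (rule le_cINF_iff)
    then show ?thesis using c by (simp add: pos_divide_le_eq mult.commute)
  qed
qed

lemma bad_vec_iff:
  fixes Nm :: "real^'m \<Rightarrow> real" and Nn :: "real^'n \<Rightarrow> real"
  assumes "is_norm Nm"
  shows "bad_vec Nm Nn A y \<longleftrightarrow> (\<exists>i j :: nat. bad_bound Nm Nn A (1 / real (Suc i)) (real j) y)"
proof -
  let ?F = "inf (filtercomap Nn at_top) (principal int_vecs)"
  let ?X = "\<lambda>q. Nn q powr (real CARD('n) / real CARD('m)) * dist_int Nm (A *v q - y)"
  have ev: "eventually P ?F \<longleftrightarrow> (\<exists>R. \<forall>q\<in>int_vecs. R \<le> Nn q \<longrightarrow> P q)" for P
    by (auto simp: eventually_inf_principal eventually_filtercomap_at_top_linorder) 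
  have bb: "bad_bound Nm Nn A \<epsilon> R y \<longleftrightarrow> (\<forall>q\<in>int_vecs. R \<le> Nn q \<longrightarrow> \<epsilon> \<le> ?X q)" for \<epsilon> R
    unfolding bad_bound_def by (simp add: le_mult_dist_int_iff[OF assms])
  show ?thesis
  proof
    assume "bad_vec Nm Nn A y"
    then have "0 < Liminf ?F (\<lambda>q. ereal (?X q))" by (simp add: bad_vec_def)
    then obtain r where r: "0 < ereal r" "ereal r < Liminf ?F (\<lambda>q. ereal (?X q))"
      using ereal_dense2 by blast
    have "\<forall>\<^sub>F q in ?F. ereal r < ereal (?X q)" using r(2) by (rule less_LiminfD)
    then obtain R where R: "\<And>q. q \<in> int_vecs \<Longrightarrow> R \<le> Nn q \<Longrightarrow> r < ?X q" unfolding ev by auto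
    obtain i where i: "1 / real (Suc i) < r" using r(1) nat_approx_posE by (metis ereal_less(2))
    obtain j :: nat where j: "R \<le> real j" using real_arch_simple by blast
    have "bad_bound Nm Nn A (1 / real (Suc i)) (real j) y"
      unfolding bb using R i j by (meson less_imp_le order_trans)
    then show "\<exists>i j :: nat. bad_bound Nm Nn A (1 / real (Suc i)) (real j) y" by blast
  next
    assume "\<exists>i j :: nat. bad_bound Nm Nn A (1 / real (Suc i)) (real j) y"
    then obtain i j :: nat where "bad_bound Nm Nn A (1 / real (Suc i)) (real j) y" by blast
    then have "\<forall>\<^sub>F q in ?F. ereal (1 / real (Suc i)) \<le> ereal (?X q)" unfolding ev bb by auto
    then have "ereal (1 / real (Suc i)) \<le> Liminf ?F (\<lambda>q. ereal (?X q))" by (rule Liminf_bounded)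
    moreover have "0 < ereal (1 / real (Suc i))" by simp
    ultimately show "bad_vec Nm Nn A y" unfolding bad_vec_def by (rule less_le_trans[rotated])
  qed
qed

lemma closed_bad_bound:
  assumes "is_norm Nm"
  shows "closed {y. bad_bound Nm Nn A \<epsilon> R y}"
proof -
  have "closed {y. \<epsilon> \<le> c * Nm (v - y - p)}" for c v p
    by (intro closed_Collect_le continuous_intros continuous_on_compose2[OF is_norm_continuous[OF assms]]) auto
  then show ?thesis
    unfolding bad_bound_def Ball_def by (intro closed_Collect_all closed_Collect_imp) auto
qed

lemma bad_bound_add_int:
  fixes Nm :: "real^'m \<Rightarrow> real" and Nn :: "real^'n \<Rightarrow> real"
  assumes "v \<in> int_vecs" "bad_bound Nm Nn A \<epsilon> R y"
  shows "bad_bound Nm Nn A \<epsilon> R (y + v)"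
  unfolding bad_bound_def
proof (intro ballI impI)
  fix q :: "real^'n" and p :: "real^'m" assume h: "q \<in> int_vecs" "R \<le> Nn q" "p \<in> int_vecs"
  have "p + v \<in> int_vecs" using assms(1) h(3) by (simp add: int_vecs_def)
  then have "\<epsilon> \<le> Nn q powr (real CARD('n) / real CARD('m)) * Nm (A *v q - y - (p + v))"
    using assms(2) h unfolding bad_bound_def by blast
  then show "\<epsilon> \<le> Nn q powr (real CARD('n) / real CARD('m)) * Nm (A *v q - (y + v) - p)"
    by (simp add: algebra_simps)
qed

definition bad_set ::
  "(real^'m \<Rightarrow> real) \<Rightarrow> (real^'n \<Rightarrow> real) \<Rightarrow> real^'n^'m \<Rightarrow> real \<Rightarrow> real \<Rightarrow> (real^'m) set set" where
  "bad_set Nm Nn A \<epsilon> R = torus_proj ` {y. bad_bound Nm Nn A \<epsilon> R y}"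

lemma torus_proj_in_bad_set_iff: "torus_proj y \<in> bad_set Nm Nn A \<epsilon> R \<longleftrightarrow> bad_bound Nm Nn A \<epsilon> R y"
proof
  assume "torus_proj y \<in> bad_set Nm Nn A \<epsilon> R"
  then obtain z where z: "bad_bound Nm Nn A \<epsilon> R z" "torus_proj y = torus_proj z"
    unfolding bad_set_def by blast
  then obtain p where "p \<in> int_vecs" "y = z + p"
    using torus_proj_self[of y] unfolding torus_proj_def by auto
  then show "bad_bound Nm Nn A \<epsilon> R y" using bad_bound_add_int z(1) by blast
qed (auto simp: bad_set_def)

lemma Bad_eq_UN:
  assumes "is_norm Nm"
  shows "Bad Nm Nn A = (\<Union>i j :: nat. bad_set Nm Nn A (1 / real (Suc i)) (real j))"
  unfolding Bad_def bad_set_def bad_vec_iff[OF assms] by blast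

lemma bad_set_measurable:
  assumes "is_norm Nm"
  shows "bad_set Nm Nn A \<epsilon> R \<in> sets torus_borel"
proof -
  let ?V = "range torus_proj - bad_set Nm Nn A \<epsilon> R"
  have "{y. torus_proj y \<in> ?V} = - {y. bad_bound Nm Nn A \<epsilon> R y}"
    by (auto simp: torus_proj_in_bad_set_iff)
  then have "openin torus_top ?V"
    using open_Compl[OF closed_bad_bound[OF assms, of Nn A \<epsilon> R]] by (simp add: openin_torus_top)
  then have "space torus_borel - ?V \<in> sets torus_borel"
    by (intro sets.compl_sets openin_sets_torus_borel)
  moreover have "space torus_borel - ?V = bad_set Nm Nn A \<epsilon> R"
    by (auto simp: space_torus_borel bad_set_def)
  ultimately show ?thesis by simp
qed

text \<open>Closeness to \<open>(0, w)\<close> makes \<open>Nn q\<close> comparable to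
  \<open>exp (m T)\<close> and \<open>Nm (A q - y - p)\<close> at most a small multiple of
  \<open>exp (- n T)\<close>. The power n/m makes the exponentials cancel exactly, leaving the
  product below \<epsilon>.\<close>

lemma bad_bound_contradiction:
  fixes Nm :: "real^'m::finite \<Rightarrow> real" and Nn :: "real^'n::finite \<Rightarrow> real"
  assumes Nm: "is_norm Nm" and Nn: "is_norm Nn"
    and Bm: "\<forall>x. Nm x \<le> Bm * norm x" and Bn: "\<forall>x. Nn x \<le> Bn * norm x" and B: "0 < Bm" "0 < Bn"
    and w: "w \<noteq> 0" and \<sigma>: "Bn * \<sigma> \<le> Nn w / 2" "(2 * Nn w) powr (real CARD('n) / real CARD('m)) * (Bm * \<sigma>) < \<epsilon>"
    and T: "2 * \<bar>R\<bar> / Nn w \<le> T" and r: "r \<in> int_vecs"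
    and close: "norm (flow T *v vpair (y - vfst r - A *v vsnd r) (- vsnd r) - vpair 0 w) < \<sigma>"
  shows "\<not> bad_bound Nm Nn A \<epsilon> R y"
proof
  assume bad: "bad_bound Nm Nn A \<epsilon> R y"
  let ?m = "real CARD('m)" and ?n = "real CARD('n)" and ?q = "vsnd r"
  define v' where "v' = exp (?n * T) *\<^sub>R (y - vfst r - A *v ?q)"
  define w' where "w' = exp (- ?m * T) *\<^sub>R (- ?q)"
  have norm_vfst: "norm (vfst x) \<le> norm x" and norm_vsnd: "norm (vsnd x) \<le> norm x" for x :: "real^('m + 'n)"
  proof -
    have "(norm x)\<^sup>2 = (norm (vfst x))\<^sup>2 + (norm (vsnd x))\<^sup>2"
      by (simp add: power2_norm_eq_inner inner_vec_def sum_UNIV_Plus)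
    then have le: "(norm (vfst x))\<^sup>2 \<le> (norm x)\<^sup>2" "(norm (vsnd x))\<^sup>2 \<le> (norm x)\<^sup>2" by simp_all
    show "norm (vfst x) \<le> norm x" by (rule power2_le_imp_le[OF le(1) norm_ge_zero])
    show "norm (vsnd x) \<le> norm x" by (rule power2_le_imp_le[OF le(2) norm_ge_zero])
  qed
  have c: "norm (vpair v' w' - vpair 0 w) < \<sigma>" using close by (simp add: flow_mult v'_def w'_def)
  then have v': "norm v' < \<sigma>" and w': "norm (w' - w) < \<sigma>"
    using norm_vfst[of "vpair v' w' - vpair 0 w"] norm_vsnd[of "vpair v' w' - vpair 0 w"] by auto
  have W: "0 < Nn w" using is_norm_pos[OF Nn w] .
  have "\<bar>Nn w' - Nn w\<bar> \<le> Nn (w' - w)" by (rule is_norm_diff[OF Nn])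
  also have "\<dots> \<le> Bn * norm (w' - w)" using Bn by blast
  also have "\<dots> \<le> Bn * \<sigma>" using w' B(2) by (intro mult_left_mono) auto
  also have "\<dots> \<le> Nn w / 2" by (rule \<sigma>(1))
  finally have Nw': "Nn w / 2 \<le> Nn w'" "Nn w' \<le> 2 * Nn w" using W by linarith+
  have "0 \<le> 2 * \<bar>R\<bar> / Nn w" using W by simp
  then have T0: "0 \<le> T" using T by linarith
  have "?q = exp (?m * T) *\<^sub>R (- w')" by (simp add: w'_def exp_minus field_simps flip: exp_add)
  then have Nq: "Nn ?q = exp (?m * T) * Nn w'" by (simp only: is_norm_scale[OF Nn] is_norm_minus[OF Nn] abs_exp_cancel)
  \<comment> \<open>From \<open>exp (m T) \<ge> T\<close>, the lower bound on \<open>T\<close>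
    yields \<open>R \<le> Nn q\<close>; the absolute value of \<open>R\<close> in that bound ensures
    \<open>T \<ge> 0\<close>.\<close>
  have "1 * T \<le> ?m * T" using T0 by (intro mult_right_mono) (simp_all add: Suc_leI)
  also have "\<dots> \<le> exp (?m * T)" using exp_ge_add_one_self[of "?m * T"] by linarith
  finally have "2 * \<bar>R\<bar> / Nn w \<le> exp (?m * T)" using T by simp
  then have "R \<le> exp (?m * T) * (Nn w / 2)" using W by (simp add: field_simps)
  also have "\<dots> \<le> Nn ?q" unfolding Nq using Nw' by (intro mult_left_mono) auto
  finally have RQ: "R \<le> Nn ?q" .
  have int: "?q \<in> int_vecs" "- vfst r \<in> int_vecs" using r by (auto simp: int_vecs_def)
  have "A *v ?q - y - (- vfst r) = exp (- ?n * T) *\<^sub>R (- v')"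
    by (simp add: v'_def flip: exp_add)
  then have Nv: "Nm (A *v ?q - y - (- vfst r)) = exp (- ?n * T) * Nm v'"
    by (simp only: is_norm_scale[OF Nm] is_norm_minus[OF Nm] abs_exp_cancel)
  have "\<epsilon> \<le> Nn ?q powr (?n / ?m) * Nm (A *v ?q - y - (- vfst r))"
    using bad int RQ unfolding bad_bound_def by blast
  also have "\<dots> = exp (?n * T) * Nn w' powr (?n / ?m) * (exp (- ?n * T) * Nm v')"
    unfolding Nq Nv using is_norm_nonneg[OF Nn, of w'] by (simp add: powr_mult exp_powr_real)
  also have "\<dots> = Nn w' powr (?n / ?m) * Nm v'"
    by (simp add: exp_minus)
  also have "\<dots> \<le> (2 * Nn w) powr (?n / ?m) * (Bm * \<sigma>)"
  proof (intro mult_mono powr_mono2)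
    show "Nm v' \<le> Bm * \<sigma>" using spec[OF Bm, of v'] v' B(1) by (meson less_imp_le mult_left_mono order_trans)
  qed (use Nw' is_norm_nonneg[OF Nn] is_norm_nonneg[OF Nm] in auto)
  finally show False using \<sigma>(2) by simp
qed

lemma matrix_vector_mult_minus_left: "(- A) *v v = - (A *v v)" for A :: "real^'n^'m"
  by (simp add: vec_eq_iff matrix_vector_mult_def sum_negf)

lemma bad_set_null:
  fixes Nm :: "real^'m::finite \<Rightarrow> real" and Nn :: "real^'n::finite \<Rightarrow> real"
  assumes Nm: "is_norm Nm" and Nn: "is_norm Nn" and cop: "coprime CARD('m) CARD('n)"
    and xs: "accum_seq (lattice_of A) xs" "length xs = CARD('m) + CARD('n)"
    and inv: "line_invariant \<mu> u" and u: "u \<noteq> 0" and \<epsilon>: "0 < \<epsilon>"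
  shows "emeasure \<mu> (bad_set Nm Nn A \<epsilon> R) = 0"
proof (rule ccontr)
  assume pos: "emeasure \<mu> (bad_set Nm Nn A \<epsilon> R) \<noteq> 0"
  interpret line_invariant \<mu> u by (rule inv)
  let ?E = "bad_set Nm Nn A \<epsilon> R"
  have E: "?E \<in> sets \<mu>" using bad_set_measurable[OF Nm] by (simp add: sets_eq)
  have "prob ?E \<noteq> 0" using pos by (simp add: emeasure_eq_measure)
  then have E_pos: "0 < prob ?E" by (simp add: zero_less_measure_iff)
  let ?G0 = "block_matrix (mat 1) A 0 (mat 1) :: real^('m + 'n)^('m + 'n)"
  have G0: "?G0 *v v = vpair (vfst v + A *v vsnd v) (vsnd v)" for v
    by (simp add: block_matrix_mult)
  have "?G0 ** block_matrix (mat 1) (- A) 0 (mat 1) = mat 1"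
    by (simp add: matrix_eq block_matrix_mult vec_sum_eq_iff matrix_vector_mult_minus_left matrix_vector_mul_lid flip: matrix_vector_mul_assoc)
  then have invG0: "invertible ?G0" by (auto simp: invertible_right_inverse)
  have e0: "vpair u (0 :: real^'n) \<noteq> 0" using u by (metis vfst_simps(4) vfst_vpair)
  obtain g where g: "det g = 1" and mix: "\<forall>S \<delta> F C. 0 < \<delta> \<longrightarrow> finite F \<longrightarrow> F \<subseteq> int_vecs - {0} \<longrightarrow> finite C \<longrightarrow>
      (\<exists>T\<ge>S. \<exists>M G. unimod M \<and> G ** M = flow T ** ?G0 \<and> dist G g < \<delta> \<and>
        (\<forall>z\<in>F. z \<bullet> (M *v vpair u 0) \<notin> C))"
    using mixing_limit[OF cop xs[unfolded lattice_of_def] invG0 e0] .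
  obtain Bm where Bm: "0 < Bm" "\<forall>x. Nm x \<le> Bm * norm x" using is_norm_le_norm[OF Nm] .
  obtain Bn where Bn: "0 < Bn" "\<forall>x. Nn x \<le> Bn * norm x" using is_norm_le_norm[OF Nn] .
  define w :: "real^'n" where "w = (\<chi> i. 1)"
  have w: "w \<noteq> 0" by (simp add: w_def vec_eq_iff)
  have W: "0 < Nn w" by (rule is_norm_pos[OF Nn w])
  let ?P = "(2 * Nn w) powr (real CARD('n) / real CARD('m))"
  have P: "0 < ?P" using W by simp
  \<comment> \<open>The first bound keeps the second component within a factor two of
    \<open>w\<close> in the norm \<open>Nn\<close>; the second pushes the product below
    \<epsilon>.\<close>
  define \<sigma> where "\<sigma> = min (Nn w / 2 / Bn) (\<epsilon> / 2 / (?P * Bm))"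
  have \<sigma>: "0 < \<sigma>" "Bn * \<sigma> \<le> Nn w / 2" "?P * (Bm * \<sigma>) < \<epsilon>"
  proof -
    show "0 < \<sigma>" using W Bn(1) Bm(1) P \<epsilon> by (simp add: \<sigma>_def)
    have "Bn * \<sigma> \<le> Bn * (Nn w / 2 / Bn)" using Bn(1) by (intro mult_left_mono) (auto simp: \<sigma>_def)
    then show "Bn * \<sigma> \<le> Nn w / 2" using Bn(1) by simp
    have "?P * Bm * \<sigma> \<le> ?P * Bm * (\<epsilon> / 2 / (?P * Bm))"
      using Bm(1) P by (intro mult_left_mono) (auto simp: \<sigma>_def)
    also have "\<dots> = \<epsilon> / 2" using Bm(1) P by simp
    finally show "?P * (Bm * \<sigma>) < \<epsilon>" using \<epsilon> by (simp add: mult.assoc)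
  qed
  obtain g' where g': "g ** g' = mat 1" using g invertible_det_nz[of g] by (auto simp: invertible_def)
  \<comment> \<open>Coordinates of \<open>(0, w)\<close> in the limit basis: the translate of the
    limit lattice by \<open>g *v b\<close> contains that point.\<close>
  define b where "b = g' *v vpair 0 w"
  have gb: "g *v b = vpair 0 w" by (simp add: b_def matrix_vector_mul_assoc g')
  \<comment> \<open>Joint continuity, because the basis and the coordinate vector are both only
    approximate.\<close>
  have "((\<lambda>X. fst X *v snd X) \<longlongrightarrow> g *v b) (nhds (g, b))"
    by (intro tendsto_matrix_vector_mult tendsto_fst[of "\<lambda>x. x" "(g, b)", simplified] tendsto_snd[of "\<lambda>x. x" "(g, b)", simplified] filterlim_ident)
  then have "\<forall>\<^sub>F X in nhds (g, b). dist (fst X *v snd X) (vpair 0 w) < \<sigma>"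
    unfolding gb using \<sigma>(1) by (rule tendstoD)
  then obtain \<eta> where \<eta>: "0 < \<eta>" "\<And>X. dist X (g, b) < \<eta> \<Longrightarrow> dist (fst X *v snd X) (vpair 0 w) < \<sigma>"
    unfolding eventually_nhds_metric by blast
  have near: "norm (G *v x - vpair 0 w) < \<sigma>" if "dist G g < \<eta> / 2" "norm (x - b) < \<eta> / 2" for G x
  proof -
    have "dist (G, x) (g, b) \<le> dist G g + dist x b"
      unfolding dist_Pair_Pair by (rule sqrt_sum_squares_le_sum) auto
    also have "\<dots> < \<eta>" using that by (simp add: dist_norm)
    finally show ?thesis using \<eta>(2)[of "(G, x)"] by (simp add: dist_norm)
  qed
  have \<eta>2: "0 < \<eta> / 2" using \<eta>(1) by simp
  obtain F :: "(real^('m + 'n)) set" and C where FC: "finite F" "F \<subseteq> int_vecs - {0}" "finite C"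
    and hit: "\<forall>Q b. (\<forall>i j. Q $ i $ j \<in> \<int>) \<longrightarrow> (\<forall>z\<in>F. z \<bullet> (Q *v u) \<notin> C) \<longrightarrow>
       (\<exists>y. torus_proj y \<in> ?E \<and> (\<exists>p\<in>int_vecs. norm (Q *v y - b - p) < \<eta> / 2))"
    using equidistribution_hits_ball[OF E E_pos \<eta>2] .
  obtain T M G where T: "2 * \<bar>R\<bar> / Nn w \<le> T" and M: "unimod M" and G: "G ** M = flow T ** ?G0" "dist G g < \<eta> / 2"
    and esc: "\<And>z. z \<in> F \<Longrightarrow> z \<bullet> (M *v vpair u 0) \<notin> C"
    using mix[rule_format, OF \<eta>2 FC, of "2 * \<bar>R\<bar> / Nn w"] by blast
  \<comment> \<open>The columns of \<open>M\<close> for the first block. As \<open>?G0\<close> fixes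
    \<open>vpair y 0\<close>, the vector \<open>Q *v y\<close> gives the coordinates of the flowed
    shift in the basis \<open>G\<close>.\<close>
  define Q :: "real^'m^('m + 'n)" where "Q = (\<chi> i j. M $ i $ Inl j)"
  have Q: "Q *v y = M *v vpair y 0" for y
    by (simp add: vec_eq_iff matrix_vector_mult_def Q_def sum_UNIV_Plus)
  have "\<exists>y. torus_proj y \<in> ?E \<and> (\<exists>p\<in>int_vecs. norm (Q *v y - b - p) < \<eta> / 2)"
    using unimod_entry_Ints[OF M] esc by (intro hit[rule_format]) (simp_all add: Q, simp add: Q_def)
  then obtain y p where y: "torus_proj y \<in> ?E" and p: "p \<in> int_vecs" "norm (Q *v y - b - p) < \<eta> / 2" by blast
  \<comment> \<open>Since \<open>M\<close> permutes the integer lattice, the integral error becomes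
    an actual pair of integer vectors for \<open>A\<close>.\<close>
  obtain r where r: "r \<in> int_vecs" "p = M *v r"
    using M p(1) unfolding unimod_def act_def by blast
  have "norm (M *v (vpair y 0 - r) - b) < \<eta> / 2"
    using p(2) by (simp add: Q r(2) matrix_vector_mult_diff_distrib algebra_simps)
  then have "norm (G *v (M *v (vpair y 0 - r)) - vpair 0 w) < \<sigma>" by (rule near[OF G(2)])
  moreover have "G *v (M *v (vpair y 0 - r)) = flow T *v vpair (y - vfst r - A *v vsnd r) (- vsnd r)"
  proof -
    have "G *v (M *v (vpair y 0 - r)) = flow T *v (?G0 *v (vpair y 0 - r))"
      by (simp add: matrix_vector_mul_assoc G(1))
    also have "?G0 *v (vpair y 0 - r) = vpair (y - vfst r - A *v vsnd r) (- vsnd r)"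
      unfolding G0 by (simp add: linear_neg[OF matrix_vector_mul_linear])
    finally show ?thesis .
  qed
  ultimately have "norm (flow T *v vpair (y - vfst r - A *v vsnd r) (- vsnd r) - vpair 0 w) < \<sigma>" by simp
  then have "\<not> bad_bound Nm Nn A \<epsilon> R y"
    by (rule bad_bound_contradiction[OF Nm Nn Bm(2) Bn(2) Bm(1) Bn(1) w \<sigma>(2,3) T r(1)])
  then show False using y by (simp add: torus_proj_in_bad_set_iff)
qed

theorem theorem1p14:
  fixes Nm :: "real^'m::finite \<Rightarrow> real" and Nn :: "real^'n::finite \<Rightarrow> real"
    and A :: "real^'n^'m" and \<mu> :: "(real^'m) set measure"
  assumes "is_norm Nm" and "is_norm Nn"
    and "coprime CARD('m) CARD('n)"
    and "\<exists>xs. accum_seq (lattice_of A) xs \<and> length xs = CARD('m) + CARD('n)"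
    and "nontrivial_algebraic_measure \<mu>"
  shows "Bad Nm Nn A \<in> null_sets \<mu>"
proof -
  obtain U where "U \<noteq> {0}" and alg: "algebraic_measure_along U \<mu>"
    using assms(5) unfolding nontrivial_algebraic_measure_def by blast
  then have U: "subspace U" and p: "prob_space \<mu>" and s: "sets \<mu> = sets torus_borel"
    and inv: "\<And>u E. u \<in> U \<Longrightarrow> E \<in> sets \<mu> \<Longrightarrow> emeasure \<mu> (torus_translate u ` E) = emeasure \<mu> E"
    unfolding algebraic_measure_along_def by blast+
  obtain u where u: "u \<in> U" "u \<noteq> 0" using \<open>U \<noteq> {0}\<close> subspace_0[OF U] by blast
  have line: "line_invariant \<mu> u"
    using p s inv subspace_scale[OF U u(1)]
    by (intro line_invariant.intro line_invariant_axioms.intro) auto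
  obtain xs where xs: "accum_seq (lattice_of A) xs" "length xs = CARD('m) + CARD('n)"
    using assms(4) by blast
  have "bad_set Nm Nn A (1 / real (Suc i)) (real j) \<in> null_sets \<mu>" for i j
    using bad_set_null[OF assms(1-3) xs line u(2)] bad_set_measurable[OF assms(1)] s
    by (intro null_setsI) auto
  then show ?thesis unfolding Bad_eq_UN[OF assms(1)] by (intro null_sets_UN) auto
qed

end
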